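(* Let $X$ be an Oeljeklaus-Toma manifold. For any closed one-form $\theta$ on $X$, there is no $d_\theta$-exact LCK form on $X$; that is, there is no LCK form $\omega$ with Lee form $\theta$ such that $\omega=d\eta-\theta\wedge\eta$ for some one-form $\eta$ on $X$.
   Context: LCK forms: a Hermitian metric $g$ on a complex manifold $(M,J)$, with fundamental two-form $\omega(X,Y)=g(JX,Y)$, is locally conformally Kähler (LCK) if there is a closed one-form $\theta$ (its Lee form) with $d\omega=\theta\wedge\omega$; $\omega$ is then called an LCK form. For a closed one-form $\theta$, $d_\theta=d-\theta\wedge\cdot$. Oeljeklaus-Toma manifolds: let $K$ be a number field with $s\geq1$ real embeddings $\sigma_1,\dots,\sigma_s$ and exactly one pair of complex conjugate embeddings $\sigma_{s+1},\overline{\sigma_{s+1}}$; let $\mathcal{O}_K$ be its ring of integers and $U$ a finite-index subgroup of the group of units $u$ with $\sigma_i(u)>0$ for $i=1,\dots,s$. Then $X=(\mathbb{H}^s\times\mathbb{C})/(U\ltimes\mathcal{O}_K)$, where $a\in\mathcal{O}_K$ acts by translation by $(\sigma_1(a),\dots,\sigma_{s+1}(a))$, $u\in U$ acts by coordinatewise multiplication by $(\sigma_1(u),\dots,\sigma_{s+1}(u))$, and $\mathbb{H}$ is the upper half-plane. Such $X$ is a compact complex manifold of complex dimension $s+1$. As is known, $X$ is a solvmanifold $G/\Gamma$ with left-invariant complex structure $J$, where the Lie algebra of $G$ is $\mathfrak{g}=\langle A_1,\dots,A_s,B_1,\dots,B_s,C_1,C_2\rangle$ with nonzero brackets $[A_i,B_i]=B_i$,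 $[A_i,C_1]=-\frac12C_1+\alpha_iC_2$, $[A_i,C_2]=-\alpha_iC_1-\frac12C_2$ ($\alpha_i\in\mathbb{R}$), and $JA_i=B_i$, $JC_1=C_2$; moreover $b_1(X)=s$. *)

theory Defs
  imports "HOL-Analysis.Analysis" "HOL-Algebra.Coset"
begin

section \<open>Differential forms on a manifold given by an atlas\<close>

text \<open>\<open>Ck_on k S f\<close> is used for open \<open>S\<close> in a finite-dimensional space only: there,
  being \<open>k+1\<close> times continuously differentiable amounts to being differentiable with all
  directional derivatives \<open>k\<close> times continuously differentiable.\<close>

primrec Ck_on :: "nat \<Rightarrow> 'v::euclidean_space set \<Rightarrow> ('v \<Rightarrow> real) \<Rightarrow> bool" where
  "Ck_on 0 S f \<longleftrightarrow> continuous_on S f"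
| "Ck_on (Suc k) S f \<longleftrightarrow> (\<forall>x\<in>S. f differentiable (at x)) \<and>
     (\<forall>v. Ck_on k S (\<lambda>x. frechet_derivative f (at x) v))"

definition smooth_on :: "'v::euclidean_space set \<Rightarrow> ('v \<Rightarrow> real) \<Rightarrow> bool" where
  "smooth_on S f \<longleftrightarrow> (\<forall>k. Ck_on k S f)"

text \<open>A chart is a pair (domain, coordinate map). The coordinate maps of the atlases below are
  injective on their domains, with open image.\<close>

type_synonym ('m, 'v) chart = "'m set \<times> ('m \<Rightarrow> 'v)"

definition chart_image :: "('m, 'v) chart \<Rightarrow> 'v set" where
  "chart_image c = snd c ` fst c"

definition transition :: "('m, 'v) chart \<Rightarrow> ('m, 'v) chart \<Rightarrow> 'v \<Rightarrow> 'v" where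
  "transition c c' = (\<lambda>x. snd c' (inv_into (fst c) (snd c) x))"

definition transition_deriv ::
  "('m, 'v::euclidean_space) chart \<Rightarrow> ('m, 'v) chart \<Rightarrow> 'm \<Rightarrow> 'v \<Rightarrow> 'v" where
  "transition_deriv c c' p = frechet_derivative (transition c c') (at (snd c p))"

text \<open>Covariant tensor fields are given by their expressions in all charts of the atlas; the
  expressions must be smooth and transform into each other under the changes of coordinates.
  Their values outside the image of the chart are irrelevant.\<close>

type_synonym ('m, 'v) field1 = "('m, 'v) chart \<Rightarrow> 'v \<Rightarrow> 'v \<Rightarrow> real"
type_synonym ('m, 'v) field2 = "('m, 'v) chart \<Rightarrow> 'v \<Rightarrow> 'v \<Rightarrow> 'v \<Rightarrow> real"
type_synonym ('m, 'v) field3 = "('m, 'v) chart \<Rightarrow> 'v \<Rightarrow> 'v \<Rightarrow> 'v \<Rightarrow> 'v \<Rightarrow> real"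

definition one_form :: "('m, 'v::euclidean_space) chart set \<Rightarrow> ('m, 'v) field1 \<Rightarrow> bool" where
  "one_form A \<alpha> \<longleftrightarrow>
     (\<forall>c\<in>A. \<forall>x\<in>chart_image c. linear (\<alpha> c x)) \<and>
     (\<forall>c\<in>A. \<forall>v. smooth_on (chart_image c) (\<lambda>x. \<alpha> c x v)) \<and>
     (\<forall>c\<in>A. \<forall>c'\<in>A. \<forall>p \<in> fst c \<inter> fst c'. \<forall>v.
        \<alpha> c (snd c p) v = \<alpha> c' (snd c' p) (transition_deriv c c' p v))"

definition two_tensor :: "('m, 'v::euclidean_space) chart set \<Rightarrow> ('m, 'v) field2 \<Rightarrow> bool" where
  "two_tensor A \<beta> \<longleftrightarrow>
     (\<forall>c\<in>A. \<forall>x\<in>chart_image c. bilinear (\<beta> c x)) \<and>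
     (\<forall>c\<in>A. \<forall>v w. smooth_on (chart_image c) (\<lambda>x. \<beta> c x v w)) \<and>
     (\<forall>c\<in>A. \<forall>c'\<in>A. \<forall>p \<in> fst c \<inter> fst c'. \<forall>v w.
        \<beta> c (snd c p) v w =
        \<beta> c' (snd c' p) (transition_deriv c c' p v) (transition_deriv c c' p w))"

definition two_form :: "('m, 'v::euclidean_space) chart set \<Rightarrow> ('m, 'v) field2 \<Rightarrow> bool" where
  "two_form A \<omega> \<longleftrightarrow> two_tensor A \<omega> \<and> (\<forall>c\<in>A. \<forall>x\<in>chart_image c. \<forall>v. \<omega> c x v v = 0)"

definition eq2 :: "('m, 'v) chart set \<Rightarrow> ('m, 'v) field2 \<Rightarrow> ('m, 'v) field2 \<Rightarrow> bool" where
  "eq2 A \<beta> \<gamma> \<longleftrightarrow> (\<forall>c\<in>A. \<forall>x\<in>chart_image c. \<forall>u v. \<beta> c x u v = \<gamma> c x u v)"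

definition eq3 :: "('m, 'v) chart set \<Rightarrow> ('m, 'v) field3 \<Rightarrow> ('m, 'v) field3 \<Rightarrow> bool" where
  "eq3 A \<beta> \<gamma> \<longleftrightarrow> (\<forall>c\<in>A. \<forall>x\<in>chart_image c. \<forall>u v w. \<beta> c x u v w = \<gamma> c x u v w)"

text \<open>Exterior derivatives and wedge products, evaluated on constant vector fields of the chart.\<close>

definition d1 :: "('m, 'v::euclidean_space) field1 \<Rightarrow> ('m, 'v) field2" where
  "d1 \<alpha> c x u v =
     frechet_derivative (\<lambda>y. \<alpha> c y v) (at x) u - frechet_derivative (\<lambda>y. \<alpha> c y u) (at x) v"

definition d2 :: "('m, 'v::euclidean_space) field2 \<Rightarrow> ('m, 'v) field3" where
  "d2 \<omega> c x u v w =
     frechet_derivative (\<lambda>y. \<omega> c y v w) (at x) u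
     - frechet_derivative (\<lambda>y. \<omega> c y u w) (at x) v
     + frechet_derivative (\<lambda>y. \<omega> c y u v) (at x) w"

definition wedge11 :: "('m, 'v) field1 \<Rightarrow> ('m, 'v) field1 \<Rightarrow> ('m, 'v) field2" where
  "wedge11 \<theta> \<eta> c x u v = \<theta> c x u * \<eta> c x v - \<theta> c x v * \<eta> c x u"

definition wedge12 :: "('m, 'v) field1 \<Rightarrow> ('m, 'v) field2 \<Rightarrow> ('m, 'v) field3" where
  "wedge12 \<theta> \<omega> c x u v w =
     \<theta> c x u * \<omega> c x v w - \<theta> c x v * \<omega> c x u w + \<theta> c x w * \<omega> c x u v"

definition closed_one_form ::
  "('m, 'v::euclidean_space) chart set \<Rightarrow> ('m, 'v) field1 \<Rightarrow> bool" where
  "closed_one_form A \<theta> \<longleftrightarrow> one_form A \<theta> \<and> eq2 A (d1 \<theta>) (\<lambda>c x u v. 0)"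

definition d_twisted ::
  "('m, 'v::euclidean_space) field1 \<Rightarrow> ('m, 'v) field1 \<Rightarrow> ('m, 'v) field2" where
  "d_twisted \<theta> \<eta> c x u v = d1 \<eta> c x u v - wedge11 \<theta> \<eta> c x u v"

definition d_twisted_exact ::
  "('m, 'v::euclidean_space) chart set \<Rightarrow> ('m, 'v) field1 \<Rightarrow> ('m, 'v) field2 \<Rightarrow> bool" where
  "d_twisted_exact A \<theta> \<omega> \<longleftrightarrow> (\<exists>\<eta>. one_form A \<eta> \<and> eq2 A \<omega> (d_twisted \<theta> \<eta>))"


section \<open>LCK forms\<close>

text \<open>\<open>J\<close> is the complex structure of the model space. The changes of coordinates of the atlas are
  meant to be holomorphic, so that \<open>J\<close> read in the charts is the complex structure of the manifold.\<close>

definition hermitian_metric ::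
  "('m, 'v::euclidean_space) chart set \<Rightarrow> ('v \<Rightarrow> 'v) \<Rightarrow> ('m, 'v) field2 \<Rightarrow> bool" where
  "hermitian_metric A J g \<longleftrightarrow> two_tensor A g \<and>
     (\<forall>c\<in>A. \<forall>x\<in>chart_image c.
        (\<forall>u v. g c x u v = g c x v u) \<and>
        (\<forall>u. u \<noteq> 0 \<longrightarrow> g c x u u > 0) \<and>
        (\<forall>u v. g c x (J u) (J v) = g c x u v))"

definition fundamental_form :: "('v \<Rightarrow> 'v) \<Rightarrow> ('m, 'v) field2 \<Rightarrow> ('m, 'v) field2" where
  "fundamental_form J g c x u v = g c x (J u) v"

definition lck_form_with_lee_form ::
  "('m, 'v::euclidean_space) chart set \<Rightarrow> ('v \<Rightarrow> 'v) \<Rightarrow> ('m, 'v) field1 \<Rightarrow> ('m, 'v) field2 \<Rightarrow> bool"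
where
  "lck_form_with_lee_form A J \<theta> \<omega> \<longleftrightarrow> two_form A \<omega> \<and>
     (\<exists>g. hermitian_metric A J g \<and> eq2 A \<omega> (fundamental_form J g)) \<and>
     closed_one_form A \<theta> \<and> eq3 A (d2 \<omega>) (wedge12 \<theta> \<omega>)"


section \<open>Number fields\<close>

definition number_field :: "'k::field_char_0 itself \<Rightarrow> bool" where
  "number_field _ \<longleftrightarrow> (\<exists>B :: 'k set. finite B \<and> module.span (\<lambda>(q::rat) x. of_rat q * x) B = UNIV)"

definition field_embedding :: "('k::field \<Rightarrow> 'l::field) \<Rightarrow> bool" where
  "field_embedding f \<longleftrightarrow>
     f 1 = 1 \<and> (\<forall>x y. f (x + y) = f x + f y) \<and> (\<forall>x y. f (x * y) = f x * f y)"

definition ring_of_integers :: "'k::field_char_0 set" where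
  "ring_of_integers = {x. algebraic_int x}"

definition integral_units :: "'k::field_char_0 set" where
  "integral_units = {u \<in> ring_of_integers. u \<noteq> 0 \<and> inverse u \<in> ring_of_integers}"

definition positive_units :: "('s \<Rightarrow> 'k::field_char_0 \<Rightarrow> real) \<Rightarrow> 'k monoid" where
  "positive_units \<sigma> =
     \<lparr>carrier = {u \<in> integral_units. \<forall>i. \<sigma> i u > 0}, mult = (*), one = 1\<rparr>"


section \<open>Oeljeklaus-Toma manifolds\<close>

text \<open>The real embeddings are indexed by the type \<open>'s\<close>, so \<open>s = CARD('s) \<ge> 1\<close>; \<open>\<tau>\<close> is the embedding
  with index \<open>s + 1\<close>.\<close>

definition oeljeklaus_toma_data ::
  "('s::finite \<Rightarrow> 'k::field_char_0 \<Rightarrow> real) \<Rightarrow> ('k \<Rightarrow> complex) \<Rightarrow> 'k set \<Rightarrow> bool" where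
  "oeljeklaus_toma_data \<sigma> \<tau> U \<longleftrightarrow>
     number_field TYPE('k) \<and>
     bij_betw \<sigma> UNIV {f. field_embedding f} \<and>
     {f :: 'k \<Rightarrow> complex. field_embedding f \<and> \<not> range f \<subseteq> \<real>} = {\<tau>, \<lambda>x. cnj (\<tau> x)} \<and>
     subgroup U (positive_units \<sigma>) \<and>
     finite (rcosets\<^bsub>positive_units \<sigma>\<^esub> U)"

text \<open>The product of \<open>s\<close> upper half-planes and the complex plane.\<close>

definition ot_cover :: "((complex^'s::finite) \<times> complex) set" where
  "ot_cover = {(z, w). \<forall>i. Im (z $ i) > 0}"

text \<open>The action of the element of the semidirect product with multiplicative part \<open>u\<close> and translation
  part \<open>a\<close>.\<close>

definition ot_act :: "('s::finite \<Rightarrow> 'k \<Rightarrow> real) \<Rightarrow> ('k \<Rightarrow> complex) \<Rightarrow> 'k \<Rightarrow> 'k \<Rightarrow>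
    (complex^'s) \<times> complex \<Rightarrow> (complex^'s) \<times> complex" where
  "ot_act \<sigma> \<tau> u a p =
     ((\<chi> i. of_real (\<sigma> i u) * fst p $ i + of_real (\<sigma> i a)), \<tau> u * snd p + \<tau> a)"

definition ot_orbit :: "('s::finite \<Rightarrow> 'k::field_char_0 \<Rightarrow> real) \<Rightarrow> ('k \<Rightarrow> complex) \<Rightarrow> 'k set \<Rightarrow>
    (complex^'s) \<times> complex \<Rightarrow> ((complex^'s) \<times> complex) set" where
  "ot_orbit \<sigma> \<tau> U p = {ot_act \<sigma> \<tau> u a p |u a. u \<in> U \<and> a \<in> ring_of_integers}"

text \<open>The points of the manifold are the orbits, and its charts are the local inverses of the quotient
  map \<open>ot_orbit \<sigma> \<tau> U\<close> on the open sets on which this map is injective. Since the action is free and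
  properly discontinuous, the chart domains cover the set of all orbits; the changes of coordinates
  are locally given by elements of the group.\<close>

definition ot_manifold :: "('s::finite \<Rightarrow> 'k::field_char_0 \<Rightarrow> real) \<Rightarrow> ('k \<Rightarrow> complex) \<Rightarrow> 'k set \<Rightarrow>
    (((complex^'s) \<times> complex) set, (complex^'s) \<times> complex) chart set" where
  "ot_manifold \<sigma> \<tau> U =
     {(ot_orbit \<sigma> \<tau> U ` V, inv_into V (ot_orbit \<sigma> \<tau> U)) |V.
        open V \<and> V \<subseteq> ot_cover \<and> inj_on (ot_orbit \<sigma> \<tau> U) V}"

definition ot_J :: "(complex^'s::finite) \<times> complex \<Rightarrow> (complex^'s) \<times> complex" where
  "ot_J v = ((\<chi> i. \<i> * fst v $ i), \<i> * snd v)"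

end

theory Submission
  imports Defs "Jordan_Normal_Form.Char_Poly" "HOL-Computational_Algebra.Field_as_Ring"
begin

text \<open>
  Write \<open>K\<close> for the number field, \<open>O\<close> for its ring of integers, and \<open>p + a\<close> for the translate of a
  point \<open>p\<close> of the cover \<open>H^s \<times> \<complex>\<close> by the vector of conjugates of \<open>a \<in> O\<close>. Suppose that
  \<open>\<omega> = d\<eta> - \<theta> \<and> \<eta>\<close> is the fundamental form of a Hermitian metric and \<open>\<theta>\<close> is closed. Lift everything to
  the cover. It is convex, so \<open>\<theta> = df\<close> there (\<open>closed_one_form_has_primitive\<close>).

  The number \<open>c a = f (p + a) - f p\<close> does not depend on \<open>p\<close>, since \<open>\<theta>\<close> is invariant and the cover is
  connected. It is additive in \<open>a\<close>, and conjugating a translation by a unit \<open>u \<in> U\<close> gives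
  \<open>c (u a) = c a\<close>. If \<open>u \<noteq> 1\<close>, then \<open>c\<close> vanishes on \<open>(u - 1) O\<close>, which contains a nonzero integer
  multiple of every \<open>a \<in> O\<close>; as the values are real, \<open>c = 0\<close>. So \<open>f\<close>, and with it the one-form
  \<open>exp (- f) \<eta>\<close>, is invariant under all translations by \<open>O\<close>
  (\<open>primitive_translation_invariant\<close>), and \<open>d (exp (- f) \<eta>) = exp (- f) \<omega>\<close>.

  Now restrict to the complex line on which the coordinates in \<open>H^s\<close> are all equal to \<open>\<i>\<close>. The
  translations by \<open>O\<close> are cocompact in the group of all translations by \<open>\<real>^s \<times> \<complex>\<close>
  (\<open>cocompact\<close>). By invariance and compactness, \<open>exp (- f) \<eta>\<close> has bounded coefficients on the line,
  and its curl is bounded below by a positive constant: it is \<open>exp (- f) \<omega> e (J e)\<close> for a tangent vector \<open>e\<close> of the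
  line, and \<open>\<omega> e (J e) = g (J e) (J e) > 0\<close>. By Stokes' theorem on a square of side \<open>R\<close> this is
  impossible for large \<open>R\<close>: the integral of the curl grows like \<open>R^2\<close> and that over the boundary only
  like \<open>R\<close> (\<open>bounded_fields_no_positive_curl\<close>).

  The arithmetic input has three parts. First, cocompactness: the embeddings of \<open>K\<close> into \<open>\<complex>\<close> are
  linearly independent (\<open>dedekind_independence\<close>), so some integers of \<open>K\<close> have linearly independent
  vectors of conjugates. Second, the quotient map is locally injective, so that the atlas has a chart at
  every point (\<open>exists_admissible\<close>): a nonzero integer has norm at least 1 in absolute value, hence
  a unit close enough to 1 at the real places is 1. Third, \<open>U\<close> contains some \<open>u \<noteq> 1\<close>: this is the
  part of Dirichlet's unit theorem that follows from Minkowski's pigeonhole argument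
  (\<open>exists_unit_not_norm_1\<close>). The last two rest on the norm, the product of all conjugates, being a
  rational number. It is the determinant of multiplication by \<open>a\<close>, because \<open>K\<close> has as many embeddings
  as its degree; the form of this that the proof uses is that every additive map \<open>K \<rightarrow> \<complex>\<close> is a
  combination of embeddings (\<open>additive_eq_sum_embeddings\<close>), and its reason is that the commuting
  operators of multiplication by elements of \<open>K\<close> can be diagonalised together.
\<close>

section \<open>Algebraic integers form a ring\<close>

text \<open>Matrices of variable size serve only for characteristic polynomials. Otherwise \<open>$\<close>, \<open>det\<close> and
  \<open>mat\<close> refer to matrices indexed by finite types.\<close>

no_notation Matrix.vec_index (infixl "$" 100)
no_notation Matrix.scalar_prod (infix "\<bullet>" 70)
hide_const (open) Determinant.det Matrix.mat Module.smult Measure_Space.additive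

abbreviation zspan :: "'k::field_char_0 set \<Rightarrow> 'k set" where
  "zspan \<equiv> module.span (\<lambda>(z::int) x. of_int z * x)"

interpretation zmod: Modules.module "\<lambda>(z::int) (x::'k::field_char_0). of_int z * x"
  by unfold_locales (auto simp: algebra_simps)

lemma zspan_mult_left:
  assumes "y \<in> zspan S" "\<And>s. s \<in> S \<Longrightarrow> x * s \<in> zspan T"
  shows "x * y \<in> zspan T"
  using assms(1)
proof (induction rule: zmod.span_induct_alt)
  case base
  then show ?case by (simp add: zmod.span_zero)
next
  case (step c s y)
  have "x * (of_int c * s + y) = of_int c * (x * s) + x * y" by (simp add: algebra_simps)
  then show ?case using step assms(2) by (simp add: zmod.span_add zmod.span_scale)
qed

text \<open>The determinant trick: multiplication by \<open>y\<close> acts on the generators \<open>S\<close> through an integer matrix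
  \<open>A\<close>, and the vector of generators is an eigenvector of \<open>A\<close> with eigenvalue \<open>y\<close>. So \<open>y\<close> is a root of
  the characteristic polynomial of \<open>A\<close>, which is monic with integer coefficients.\<close>

lemma algebraic_int_if_zspan_stable:
  fixes y :: "'k::field_char_0"
  assumes "finite S" "s0 \<in> S" "s0 \<noteq> 0" and stable: "\<And>s. s \<in> S \<Longrightarrow> y * s \<in> zspan S"
  shows "algebraic_int y"
proof -
  obtain xs where xs: "set xs = S" "distinct xs" using finite_distinct_list[OF assms(1)] by blast
  define n where "n = length xs"
  have "\<forall>s\<in>S. \<exists>c. y * s = (\<Sum>t\<in>S. of_int (c t) * t)"
    using stable assms(1) by (auto simp: zmod.span_finite)
  then obtain c where c: "\<And>s. s \<in> S \<Longrightarrow> y * s = (\<Sum>t\<in>S. of_int (c s t) * t)" by metis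
  define A :: "int mat" where "A = Matrix.mat n n (\<lambda>(i,j). c (xs!i) (xs!j))"
  define v where "v = Matrix.vec n (\<lambda>i. xs!i)"
  have A: "A \<in> carrier_mat n n" by (simp add: A_def)
  let ?A = "map_mat of_int A :: 'k mat"
  have A': "?A \<in> carrier_mat n n" using A by simp
  have "?A *\<^sub>v v = y \<cdot>\<^sub>v v"
  proof (rule eq_vecI)
    fix i assume "i < dim_vec (y \<cdot>\<^sub>v v)"
    then have i: "i < n" by (simp add: v_def)
    have "vec_index (?A *\<^sub>v v) i = (\<Sum>j<n. of_int (c (xs!i) (xs!j)) * xs!j)"
      using i by (simp add: A_def v_def scalar_prod_def lessThan_atLeast0)
    also have "\<dots> = (\<Sum>t\<in>S. of_int (c (xs!i) t) * t)"
      by (rule sum.reindex_bij_betw)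
        (use xs n_def in \<open>auto intro!: bij_betw_nth\<close>)
    also have "\<dots> = y * xs!i" using c[of "xs!i"] i xs n_def by auto
    finally show "vec_index (?A *\<^sub>v v) i = vec_index (y \<cdot>\<^sub>v v) i" using i by (simp add: v_def)
  qed (use A in \<open>auto simp: v_def\<close>)
  moreover have "v \<noteq> 0\<^sub>v n"
  proof -
    obtain i where "i < n" "xs!i = s0" using assms(2) xs n_def by (auto simp: in_set_conv_nth)
    then have "vec_index v i \<noteq> vec_index (0\<^sub>v n) i" using assms(3) by (simp add: v_def)
    then show ?thesis by auto
  qed
  ultimately have "eigenvalue ?A y"
    unfolding eigenvalue_def eigenvector_def using A by (intro exI[of _ v]) (auto simp: v_def)
  then have "poly (map_poly of_int (char_poly A)) y = 0"
    using eigenvalue_root_char_poly[OF A'] of_int_hom.char_poly_hom[OF A] by metis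
  moreover have "lead_coeff (char_poly A) = 1" using degree_monic_char_poly[OF A] by simp
  ultimately show ?thesis by (auto simp: algebraic_int_altdef_ipoly)
qed

lemma algebraic_int_power_in_zspan:
  fixes x :: "'k::field_char_0"
  assumes "algebraic_int x"
  obtains d where "d > 0" "x ^ d \<in> zspan ((\<lambda>i. x ^ i) ` {..<d})"
proof -
  obtain p :: "int poly" where p: "poly (map_poly of_int p) x = 0" "lead_coeff p = 1"
    using assms by (auto simp: algebraic_int_altdef_ipoly)
  define d where "d = degree p"
  have d0: "d > 0"
  proof (rule ccontr)
    assume "\<not> d > 0"
    then have "p = [:1:]" using p(2) unfolding d_def
      by (metis degree_eq_zeroE lead_coeff_pCons(2) gr0I pCons_0_0 coeff_pCons_0 degree_pCons_0)
    then show False using p(1) by simp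
  qed
  have "0 = (\<Sum>i\<le>d. of_int (coeff p i) * x ^ i)"
    using p(1) by (simp add: poly_altdef d_def)
  also have "\<dots> = (\<Sum>i<d. of_int (coeff p i) * x ^ i) + x ^ d"
    using p(2) by (simp add: lessThan_Suc_atMost[symmetric] d_def)
  finally have "x ^ d = - (\<Sum>i<d. of_int (coeff p i) * x ^ i)" by (simp add: eq_neg_iff_add_eq_0 add.commute)
  also have "\<dots> \<in> zspan ((\<lambda>i. x ^ i) ` {..<d})"
    by (intro zmod.span_neg zmod.span_sum zmod.span_scale zmod.span_base) auto
  finally show ?thesis using d0 that by blast
qed

lemma
  fixes x y :: "'k::field_char_0"
  assumes "algebraic_int x" "algebraic_int y"
  shows algebraic_int_add: "algebraic_int (x + y)"
    and algebraic_int_mult: "algebraic_int (x * y)"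
proof -
  obtain d e where d: "d > 0" "x ^ d \<in> zspan ((\<lambda>i. x ^ i) ` {..<d})"
    and e: "e > 0" "y ^ e \<in> zspan ((\<lambda>i. y ^ i) ` {..<e})"
    using algebraic_int_power_in_zspan assms by metis
  \<comment> \<open>The monomials of bounded exponents span a module that is stable under multiplication by \<open>x\<close> and by \<open>y\<close>.\<close>
  define S where "S = (\<lambda>(i,j). x ^ i * y ^ j) ` ({..<d} \<times> {..<e})"
  have S: "x ^ i * y ^ j \<in> zspan S" if "i < d" "j < e" for i j
    using that by (auto simp: S_def intro!: zmod.span_base)
  have xS: "x * s \<in> zspan S" if "s \<in> S" for s
  proof -
    from that obtain i j where ij: "i < d" "j < e" "s = x ^ i * y ^ j" by (auto simp: S_def)
    show ?thesis
    proof (cases "Suc i < d")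
      case True then show ?thesis using S[of "Suc i" j] ij by (simp add: mult_ac)
    next
      case False
      then have "x * s = y ^ j * x ^ d" using ij by (metis Suc_lessI mult.commute mult.left_commute power_Suc)
      also have "\<dots> \<in> zspan S"
        by (rule zspan_mult_left[OF d(2)]) (use S ij in \<open>auto simp: mult.commute[of "y ^ j"]\<close>)
      finally show ?thesis .
    qed
  qed
  have yS: "y * s \<in> zspan S" if "s \<in> S" for s
  proof -
    from that obtain i j where ij: "i < d" "j < e" "s = x ^ i * y ^ j" by (auto simp: S_def)
    show ?thesis
    proof (cases "Suc j < e")
      case True then show ?thesis using S[of i "Suc j"] ij by (simp add: mult_ac)
    next
      case False
      then have "y * s = x ^ i * y ^ e" using ij by (metis Suc_lessI mult.left_commute power_Suc)
      also have "\<dots> \<in> zspan S"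
        by (rule zspan_mult_left[OF e(2)]) (use S ij in auto)
      finally show ?thesis .
    qed
  qed
  have fin: "finite S" and one: "1 \<in> S"
    using d(1) e(1) by (auto simp: S_def intro!: image_eqI[of _ _ "(0,0)"])
  show "algebraic_int (x + y)"
    by (rule algebraic_int_if_zspan_stable[OF fin one])
      (use xS yS in \<open>auto simp: distrib_right zmod.span_add\<close>)
  show "algebraic_int (x * y)"
    by (rule algebraic_int_if_zspan_stable[OF fin one])
      (use zspan_mult_left[OF yS xS] in \<open>auto simp: mult.assoc\<close>)
qed

lemma algebraic_int_diff:
  "algebraic_int x \<Longrightarrow> algebraic_int y \<Longrightarrow> algebraic_int (x - y :: 'a::field_char_0)"
  using algebraic_int_add[of x "- y"] by simp

lemma algebraic_int_sum:
  "(\<And>i. i \<in> A \<Longrightarrow> algebraic_int (g i :: 'a::field_char_0)) \<Longrightarrow> algebraic_int (sum g A)"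
  by (induction A rule: infinite_finite_induct) (auto intro: algebraic_int_add)

lemma algebraic_int_prod:
  "(\<And>i. i \<in> A \<Longrightarrow> algebraic_int (g i :: 'a::field_char_0)) \<Longrightarrow> algebraic_int (prod g A)"
  by (induction A rule: infinite_finite_induct) (auto intro: algebraic_int_mult)

text \<open>The multiplier is the leading coefficient \<open>N\<close> of an equation of degree \<open>d\<close> for \<open>x\<close>. Multiplied by
  \<open>N ^ (d - 1)\<close>, that equation becomes a monic one for \<open>N x\<close>.\<close>

lemma algebraic_imp_algebraic_int_multiple:
  fixes x :: "'a::field_char_0"
  assumes "p \<noteq> 0" "poly (map_poly of_int p) x = 0"
  obtains N :: int where "N \<noteq> 0" "algebraic_int (of_int N * x)"
proof -
  define N where "N = lead_coeff p"
  define y where "y = of_int N * x"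
  define d where "d = degree p"
  have N: "N \<noteq> 0" using assms N_def by simp
  have d: "d > 0"
  proof (rule ccontr)
    assume "\<not> d > 0"
    then obtain c where "p = [:c:]" unfolding d_def by (metis degree_eq_zeroE gr0I)
    then show False using assms by simp
  qed
  have "0 = of_int N ^ (d - 1) * (\<Sum>i\<le>d. of_int (coeff p i) * x ^ i)"
    using assms(2) by (simp add: poly_altdef d_def)
  also have "\<dots> = of_int N ^ (d - 1) * (of_int N * x ^ d) + of_int N ^ (d - 1) * (\<Sum>i<d. of_int (coeff p i) * x ^ i)"
    by (simp add: lessThan_Suc_atMost[symmetric] d_def N_def algebra_simps)
  also have "of_int N ^ (d - 1) * (of_int N * x ^ d) = y ^ d"
    using d by (cases d) (auto simp: y_def power_mult_distrib)
  also have "of_int N ^ (d - 1) * (\<Sum>i<d. of_int (coeff p i) * x ^ i)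
      = (\<Sum>i<d. of_int (coeff p i * N ^ (d - 1 - i)) * y ^ i)"
    unfolding sum_distrib_left
  proof (rule sum.cong[OF refl])
    fix i assume "i \<in> {..<d}"
    then have "d - 1 = (d - 1 - i) + i" by auto
    then have "(of_int N :: 'a) ^ (d - 1) = of_int N ^ (d - 1 - i) * of_int N ^ i" by (metis power_add)
    then show "of_int N ^ (d - 1) * (of_int (coeff p i) * x ^ i) = of_int (coeff p i * N ^ (d - 1 - i)) * y ^ i"
      by (simp add: y_def power_mult_distrib mult_ac)
  qed
  finally have yd: "y ^ d = - (\<Sum>i<d. of_int (coeff p i * N ^ (d - 1 - i)) * y ^ i)"
    by (simp add: eq_neg_iff_add_eq_0)
  let ?S = "(\<lambda>i. y ^ i) ` {..<d}"
  have yd': "y ^ d \<in> zspan ?S" unfolding yd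
    by (intro zmod.span_neg zmod.span_sum zmod.span_scale zmod.span_base) auto
  have "algebraic_int y"
  proof (rule algebraic_int_if_zspan_stable[of ?S 1])
    show "1 \<in> ?S" using d by (auto intro!: image_eqI[of _ _ 0])
    fix s assume "s \<in> ?S"
    then obtain i where i: "i < d" "s = y ^ i" by auto
    show "y * s \<in> zspan ?S"
    proof (cases "Suc i < d")
      case True
      then have "y ^ Suc i \<in> ?S" by blast
      then show ?thesis using i by (simp add: zmod.span_base)
    next
      case False
      then have "d = Suc i" using i by auto
      then show ?thesis using yd' i by simp
    qed
  qed auto
  then show ?thesis using that N y_def by blast
qed

section \<open>Embeddings span the additive functionals on a number field\<close>

interpretation qvs: vector_space "\<lambda>(q::rat) (x::'k::field_char_0). of_rat q * x"
  by unfold_locales (auto simp: algebra_simps of_rat_add of_rat_mult)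

interpretation of_rat_poly: map_poly_idom_hom "of_rat :: rat \<Rightarrow> 'a::field_char_0" ..

lemma number_field_iff:
  "number_field TYPE('k::field_char_0) \<longleftrightarrow> (\<exists>B::'k set. finite B \<and> qvs.span B = UNIV)"
  by (simp add: number_field_def)

text \<open>Additivity implies rational linearity, so the rational functionals on a number field are its additive maps.\<close>

lemma additive_of_rat:
  fixes l :: "'k::field_char_0 \<Rightarrow> 'l::field_char_0"
  assumes "additive l"
  shows "l (of_rat q * x) = of_rat q * l x"
proof -
  interpret additive l by fact
  have nat: "l (of_nat n * x) = of_nat n * l x" for n x
    by (induction n) (auto simp: add zero distrib_right)
  have int: "l (of_int z * x) = of_int z * l x" for z x
    by (cases z) (auto simp: nat minus distrib_right simp del: of_nat_Suc)
  obtain a b where q: "q = Rat.Fract a b" "b > 0" by (cases q) auto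
  have "of_int b * l (of_rat q * x) = l (of_int b * (of_rat q * x))" by (simp add: int)
  also have "of_int b * (of_rat q * x) = of_int a * x" using q by (simp add: of_rat_rat)
  also have "l (of_int a * x) = of_int a * l x" by (rule int)
  finally show ?thesis using q by (simp add: of_rat_rat field_simps)
qed

lemma of_real_of_rat: "complex_of_real (of_rat q) = of_rat q"
proof -
  have "additive complex_of_real" by unfold_locales simp
  from additive_of_rat[OF this, of q 1] show ?thesis by simp
qed

lemma number_field_algebraic:
  fixes a :: "'k::field_char_0"
  assumes "number_field TYPE('k)"
  obtains p :: "rat poly" where "p \<noteq> 0" "poly (map_poly of_rat p) a = 0"
proof -
  obtain B :: "'k set" where B: "finite B" "qvs.span B = UNIV" using assms number_field_iff by blast
  let ?n = "card B"
  have ev: "poly (map_poly of_rat (\<Sum>i\<le>n. monom (c i) i)) a = (\<Sum>i\<le>n. of_rat (c i) * a ^ i)" for n c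
    by (simp add: of_rat_poly.hom_sum map_poly_monom poly_monom poly_sum)
  have co: "coeff (\<Sum>i\<le>n. monom (c i) i) k = (if k \<le> n then c k else 0)" for c :: "nat \<Rightarrow> rat" and n k
    by (simp add: coeff_sum)
  show ?thesis
  proof (cases "inj_on (\<lambda>i. a ^ i) {..?n}")
    case False
    then obtain i j where ij: "a ^ i = a ^ j" "i \<noteq> j" by (auto simp: inj_on_def)
    show ?thesis
    proof (rule that[of "monom 1 i - monom 1 j"])
      show "monom 1 i - monom 1 j \<noteq> (0::rat poly)" using ij by (simp add: monom_eq_iff')
      show "poly (map_poly of_rat (monom 1 i - monom 1 j)) a = 0"
        using ij by (simp add: of_rat_poly.hom_minus map_poly_monom poly_monom)
    qed
  next
    case True
    let ?S = "(\<lambda>i. a ^ i) ` {..?n}"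
    have "card ?S = Suc ?n" using True by (simp add: card_image)
    then have "qvs.dependent ?S"
      using qvs.independent_span_bound[OF B(1), of ?S] B(2) by auto
    then obtain u v where u: "v \<in> ?S" "u v \<noteq> 0" "(\<Sum>v\<in>?S. of_rat (u v) * v) = 0"
      using qvs.dependent_finite[of ?S] by auto
    from u(1) obtain k where k: "k \<le> ?n" "v = a ^ k" by auto
    let ?p = "\<Sum>i\<le>?n. monom (u (a ^ i)) i"
    have "coeff ?p k \<noteq> 0" using k u by (simp only: co) simp
    then have "?p \<noteq> 0" by (metis coeff_0)
    moreover have "poly (map_poly of_rat ?p) a = 0"
      unfolding ev using u(3) by (simp add: sum.reindex[OF True])
    ultimately show ?thesis using that by blast
  qed
qed

text \<open>A rational polynomial \<open>p\<close> of least degree annihilating \<open>a\<close> is coprime to its derivative: otherwise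
  their gcd or its cofactor in \<open>p\<close> would vanish at \<open>a\<close>, and both have smaller degree than \<open>p\<close>. So \<open>p\<close> has no multiple root in \<open>\<complex>\<close>; this is what makes multiplication by \<open>a\<close>
  diagonalisable.\<close>

lemma number_field_separable_annihilator:
  fixes a :: "'k::field_char_0"
  assumes "number_field TYPE('k)"
  obtains p :: "rat poly" where "poly (map_poly of_rat p) a = 0"
    "rsquarefree (map_poly of_rat p :: complex poly)"
proof -
  define Q where "Q = (\<lambda>p::rat poly. p \<noteq> 0 \<and> poly (map_poly of_rat p) a = 0)"
  obtain p0 where "Q p0" using number_field_algebraic[OF assms, of a] Q_def by blast
  define p where "p = (ARG_MIN degree p. Q p)"
  have p: "Q p" and min: "\<And>q. Q q \<Longrightarrow> degree p \<le> degree q"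
    using arg_min_nat_lemma[of Q p0 degree] \<open>Q p0\<close> p_def by auto
  have deg: "degree p > 0"
  proof (rule ccontr)
    assume "\<not> degree p > 0"
    then obtain c where "p = [:c:]" by (metis degree_eq_zeroE gr0I)
    then show False using p by (auto simp: Q_def)
  qed
  define g where "g = gcd p (pderiv p)"
  have "pderiv p \<noteq> 0" using deg by (simp add: pderiv_eq_0_iff)
  have "degree g \<le> degree (pderiv p)" unfolding g_def
    by (rule dvd_imp_degree_le) (use \<open>pderiv p \<noteq> 0\<close> in auto)
  then have dg: "degree g < degree p" using deg by (simp add: degree_pderiv)
  obtain h where h: "p = g * h" using g_def by (metis dvd_def gcd_dvd1)
  have "g \<noteq> 0" "h \<noteq> 0" using p h by (auto simp: Q_def)
  have dsum: "degree p = degree g + degree h" using h \<open>g \<noteq> 0\<close> \<open>h \<noteq> 0\<close> by (simp add: degree_mult_eq)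
  have "poly (map_poly of_rat g) a * poly (map_poly of_rat h) a = 0"
    using p h by (simp add: Q_def of_rat_poly.hom_mult)
  moreover have "poly (map_poly of_rat g) a \<noteq> 0"
    using min[of g] dg \<open>g \<noteq> 0\<close> by (auto simp: Q_def)
  ultimately have "Q h" using \<open>h \<noteq> 0\<close> by (simp add: Q_def)
  then have "degree g = 0" using min dsum by force
  then have "is_unit g" using \<open>g \<noteq> 0\<close> by (simp add: is_unit_iff_degree)
  then have cop: "coprime p (pderiv p)" unfolding g_def by (rule is_unit_gcd[THEN iffD1])
  obtain u v where uv: "u * p + v * pderiv p = 1"
    using cop by (metis bezout_coefficients_fst_snd coprime_iff_gcd_eq_1)
  let ?h = "map_poly of_rat :: rat poly \<Rightarrow> complex poly"
  have "?h u * ?h p + ?h v * pderiv (?h p) = 1"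
    using arg_cong[OF uv, of ?h]
    by (simp add: of_rat_poly.hom_mult of_rat_poly.hom_add of_rat_hom.map_poly_pderiv)
  then have "poly (?h u) z * poly (?h p) z + poly (?h v) z * poly (pderiv (?h p)) z = 1" for z
    by (metis poly_1 poly_add poly_mult)
  then have "\<not> (poly (?h p) z = 0 \<and> poly (pderiv (?h p)) z = 0)" for z
    by (metis add.right_neutral mult_zero_right zero_neq_one)
  then have "rsquarefree (?h p)" by (simp add: rsquarefree_roots)
  then show ?thesis using p that by (auto simp: Q_def)
qed

text \<open>The operator \<open>T\<close> of multiplication by \<open>a\<close> acts on functionals by \<open>(T l) x = l (a * x)\<close>; this is
  \<open>Q(T) l\<close> for a complex polynomial \<open>Q\<close>.\<close>

definition poly_act :: "('k::field_char_0 \<Rightarrow> complex) \<Rightarrow> 'k \<Rightarrow> complex poly \<Rightarrow> 'k \<Rightarrow> complex" where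
  "poly_act l a Q x = (\<Sum>i\<le>degree Q. coeff Q i * l (a ^ i * x))"

lemma poly_act_eq:
  "degree Q \<le> n \<Longrightarrow> poly_act l a Q x = (\<Sum>i\<le>n. coeff Q i * l (a ^ i * x))"
  unfolding poly_act_def by (rule sum.mono_neutral_left) (auto simp: coeff_eq_0)

lemma poly_act_0: "poly_act l a 0 x = 0"
  by (simp add: poly_act_def)

lemma poly_act_add: "poly_act l a (P + Q) x = poly_act l a P x + poly_act l a Q x"
proof -
  let ?n = "max (degree P) (degree Q)"
  show ?thesis
    using poly_act_eq[of "P + Q" ?n l a x] poly_act_eq[of P ?n l a x] poly_act_eq[of Q ?n l a x]
    by (simp add: degree_add_le_max distrib_right sum.distrib)
qed

lemma poly_act_smult: "poly_act l a (smult c P) x = c * poly_act l a P x"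
  using poly_act_eq[of "smult c P" "degree P" l a x]
  by (simp add: poly_act_def sum_distrib_left mult_ac)

lemma poly_act_sum: "poly_act l a (sum P A) x = (\<Sum>i\<in>A. poly_act l a (P i) x)"
  by (induction A rule: infinite_finite_induct) (auto simp: poly_act_0 poly_act_add)

lemma poly_act_1: "poly_act l a 1 x = l x"
  by (simp add: poly_act_def)

lemma poly_act_pCons_0: "poly_act l a (pCons 0 Q) x = poly_act l a Q (a * x)"
proof -
  have "poly_act l a (pCons 0 Q) x = (\<Sum>i\<le>Suc (degree Q). coeff (pCons 0 Q) i * l (a ^ i * x))"
    by (rule poly_act_eq) (rule degree_pCons_le)
  also have "\<dots> = (\<Sum>i\<le>degree Q. coeff Q i * l (a ^ Suc i * x))"
    by (subst sum.atMost_Suc_shift) simp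
  finally show ?thesis by (simp add: poly_act_def mult_ac)
qed

lemma poly_act_root:
  "poly_act l a ([:-r, 1:] * Q) x = poly_act l a Q (a * x) - r * poly_act l a Q x"
proof -
  have "[:-r, 1:] * Q = smult (-r) Q + pCons 0 Q" by simp
  then show ?thesis by (simp only: poly_act_add poly_act_smult poly_act_pCons_0) simp
qed

lemma poly_act_of_rat:
  assumes "additive l"
  shows "poly_act l a (map_poly of_rat p) x = l (poly (map_poly of_rat p) a * x)"
proof -
  interpret additive l by fact
  have "poly_act l a (map_poly of_rat p) x = (\<Sum>i\<le>degree p. l (of_rat (coeff p i) * (a ^ i * x)))"
    by (simp add: poly_act_def additive_of_rat[OF assms])
  also have "\<dots> = l (\<Sum>i\<le>degree p. of_rat (coeff p i) * (a ^ i * x))" by (simp add: sum)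
  also have "(\<Sum>i\<le>degree p. of_rat (coeff p i) * (a ^ i * x)) = poly (map_poly of_rat p) a * x"
    by (simp add: poly_altdef sum_distrib_right mult.assoc)
  finally show ?thesis .
qed

text \<open>The Lagrange basis polynomials of the nodes \<open>R\<close> add up to 1, the polynomial that interpolates the
  constant 1.\<close>

lemma lagrange_partition_of_unity:
  fixes R :: "'a::field set"
  assumes "finite R" "R \<noteq> {}"
  shows "(\<Sum>r\<in>R. smult (inverse (\<Prod>t\<in>R-{r}. r - t)) (\<Prod>t\<in>R-{r}. [:-t, 1:])) = 1" (is "?L = 1")
proof (rule poly_eqI_degree[of R])
  have deg: "degree (\<Prod>t\<in>R-{r}. [:-t, 1:]) = card R - 1" if "r \<in> R" for r
    using assms that by (subst degree_prod_eq_sum_degree) auto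
  have "degree ?L \<le> card R - 1"
    by (rule degree_sum_le) (use assms deg in \<open>auto intro: order.trans[OF degree_smult_le]\<close>)
  moreover have "card R > 0" using assms by (simp add: card_gt_0_iff)
  ultimately show "degree ?L < card R" "degree (1::'a poly) < card R" by auto
  fix x assume x: "x \<in> R"
  have "poly ?L x = (\<Sum>r\<in>R. inverse (\<Prod>t\<in>R-{r}. r - t) * (\<Prod>t\<in>R-{r}. x - t))"
    by (simp add: poly_sum poly_prod)
  also have "\<dots> = (\<Sum>r\<in>R. if r = x then 1 else 0)"
  proof (rule sum.cong[OF refl])
    fix r assume r: "r \<in> R"
    show "inverse (\<Prod>t\<in>R-{r}. r - t) * (\<Prod>t\<in>R-{r}. x - t) = (if r = x then 1 else 0)"
    proof (cases "r = x")
      case True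
      then have "(\<Prod>t\<in>R-{r}. r - t) \<noteq> 0" using assms by (auto simp: prod_zero_iff)
      then show ?thesis using True by auto
    next
      case False
      then have "(\<Prod>t\<in>R-{r}. x - t) = 0" using assms x by (auto simp: prod_zero_iff)
      then show ?thesis using False by auto
    qed
  qed
  also have "\<dots> = 1" using assms x by simp
  finally show "poly ?L x = poly 1 x" by simp
qed

text \<open>The components are \<open>m r = L\<^sub>r(T) l\<close> for the operator \<open>T\<close> of multiplication by \<open>a\<close> and the Lagrange basis
  polynomials \<open>L\<^sub>r\<close> of the roots \<open>R\<close> of an annihilator \<open>p\<close> of \<open>a\<close>. They are eigenvectors as
  \<open>(X - r) L\<^sub>r\<close> is a multiple of \<open>p\<close>. The last conclusion says that eigenvectors of another multiplication
  operator are preserved, since it commutes with \<open>T\<close>; it allows the decomposition to be iterated.\<close>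

lemma eigen_decomposition:
  fixes l :: "'k::field_char_0 \<Rightarrow> complex"
  assumes "number_field TYPE('k)" "additive l"
  obtains R and m :: "complex \<Rightarrow> 'k \<Rightarrow> complex" where
    "finite R" "\<And>x. l x = (\<Sum>r\<in>R. m r x)" "\<And>r. additive (m r)"
    "\<And>r x. r \<in> R \<Longrightarrow> m r (a * x) = r * m r x"
    "\<And>r b s. \<forall>x. l (b * x) = s * l x \<Longrightarrow> \<forall>x. m r (b * x) = s * m r x"
proof -
  interpret additive l by fact
  obtain p :: "rat poly" where p: "poly (map_poly of_rat p) a = 0"
    "rsquarefree (map_poly of_rat p :: complex poly)"
    using number_field_separable_annihilator[OF assms(1)] by blast
  let ?P = "map_poly of_rat p :: complex poly"
  define R where "R = {z. poly ?P z = 0}"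
  have P0: "?P \<noteq> 0" using p(2) by (auto simp: rsquarefree_def)
  have fin: "finite R" unfolding R_def by (rule poly_roots_finite[OF P0])
  have dec: "smult (lead_coeff ?P) (\<Prod>z\<in>R. [:-z, 1:]) = ?P"
    unfolding R_def by (rule complex_poly_decompose_rsquarefree[OF p(2)])
  have ne: "R \<noteq> {}"
  proof
    assume "R = {}"
    then have "?P = [:lead_coeff ?P:]" using dec by simp
    then have "degree ?P = 0" by (metis degree_pCons_0)
    then have "degree p = 0" by simp
    then obtain c where "p = [:c:]" by (rule degree_eq_zeroE)
    then show False using p(1) P0 by auto
  qed
  define L where "L = (\<lambda>r. smult (inverse (\<Prod>t\<in>R-{r}. r - t)) (\<Prod>t\<in>R-{r}. [:-t, 1:]))"
  have sumL: "(\<Sum>r\<in>R. L r) = 1" unfolding L_def by (rule lagrange_partition_of_unity[OF fin ne])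
  have rootL: "\<exists>c. [:-r, 1:] * L r = smult c ?P" if "r \<in> R" for r
  proof -
    have "lead_coeff ?P \<noteq> 0" using P0 by simp
    have "[:-r, 1:] * L r = smult (inverse (\<Prod>t\<in>R-{r}. r - t)) (\<Prod>z\<in>R. [:-z, 1:])"
      unfolding L_def by (subst prod.remove[OF fin that]) (simp only: mult_smult_right)
    also have "(\<Prod>z\<in>R. [:-z, 1:]) = smult (inverse (lead_coeff ?P)) ?P"
      by (subst dec[symmetric]) (use \<open>lead_coeff ?P \<noteq> 0\<close> in simp)
    finally show ?thesis by auto
  qed
  define m where "m = (\<lambda>r. poly_act l a (L r))"
  show ?thesis
  proof (rule that[of R m])
    show "finite R" by fact
    show "l x = (\<Sum>r\<in>R. m r x)" for x
      using poly_act_sum[of l a L R x] by (simp add: sumL poly_act_1 m_def)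
    show "additive (m r)" for r
      by unfold_locales (simp add: m_def poly_act_def add distrib_left sum.distrib)
    show "m r (a * x) = r * m r x" if r: "r \<in> R" for r x
    proof -
      obtain c where c: "[:-r, 1:] * L r = smult c ?P" using rootL[OF r] by blast
      have "poly_act l a (smult c ?P) x = 0"
        by (simp add: poly_act_smult poly_act_of_rat[OF assms(2)] p(1) zero)
      then have "poly_act l a ([:-r, 1:] * L r) x = 0" by (simp only: c)
      then show ?thesis by (simp only: poly_act_root m_def) simp
    qed
    show "\<forall>x. m r (b * x) = s * m r x" if "\<forall>x. l (b * x) = s * l x" for r b s
    proof
      fix x
      have "l (a ^ i * (b * x)) = s * l (a ^ i * x)" for i
        using that[rule_format, of "a ^ i * x"] by (simp add: mult_ac)
      then show "m r (b * x) = s * m r x" by (simp add: m_def poly_act_def sum_distrib_left mult_ac)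
    qed
  qed
qed

lemma field_embedding_imp_field_hom: "field_embedding g \<Longrightarrow> field_hom g"
  unfolding field_embedding_def
  by unfold_locales (auto, metis add_cancel_right_right)

text \<open>The index type of the embeddings doubles below as the index type of a basis of the field, so that the
  conjugates of a basis form a square matrix.\<close>

locale number_field_embeddings =
  fixes f :: "'n::finite \<Rightarrow> 'k::field_char_0 \<Rightarrow> complex"
  assumes number_field: "number_field TYPE('k)"
    and inj_f: "inj f" and range_f: "range f = {g. field_embedding g}"
begin

sublocale f: field_hom "f i" for i
  using range_f by (intro field_embedding_imp_field_hom) auto

lemma f_eq_iff [simp]: "f i x = f i y \<longleftrightarrow> x = y"
  by (metis f.hom_minus eq_iff_diff_eq_0 f.hom_0_iff)

lemma f_of_rat [simp]: "f i (of_rat q) = of_rat q"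
proof -
  have "additive (f i)" by unfold_locales (simp add: f.hom_add)
  from additive_of_rat[OF this, of q 1] show ?thesis by simp
qed

text \<open>Induction on the number of terms. For \<open>f i y \<noteq> f j y\<close>, subtracting \<open>f j y\<close> times the relation at \<open>x\<close>
  from the relation at \<open>y * x\<close> removes the term of \<open>j\<close> and keeps that of \<open>i\<close>.\<close>

lemma dedekind_independence:
  assumes "\<And>x. (\<Sum>i\<in>UNIV. c i * f i x) = 0"
  shows "c i = 0"
proof -
  have *: "\<forall>c. (\<forall>x. (\<Sum>i\<in>S. c i * f i x) = 0) \<longrightarrow> (\<forall>i\<in>S. c i = 0)" if "finite S" for S
    using that
  proof (induction S)
    case empty
    then show ?case by simp
  next
    case (insert j S)
    show ?case
    proof (intro allI impI)
      fix c assume c: "\<forall>x. (\<Sum>i\<in>insert j S. c i * f i x) = 0"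
      have S0: "c i = 0" if i: "i \<in> S" for i
      proof -
        have "i \<noteq> j" using i insert by auto
        then obtain y where y: "f i y \<noteq> f j y" using inj_f by (metis injD ext)
        have "(\<Sum>i\<in>S. (c i * (f i y - f j y)) * f i x) = 0" for x
        proof -
          have "c j * f j (y * x) + (\<Sum>i\<in>S. c i * f i (y * x)) = 0"
            "c j * f j x + (\<Sum>i\<in>S. c i * f i x) = 0" using c insert by auto
          then have "(c j * f j (y * x) + (\<Sum>i\<in>S. c i * f i (y * x)))
              - f j y * (c j * f j x + (\<Sum>i\<in>S. c i * f i x)) = 0" by simp
          then show ?thesis
            by (simp add: f.hom_mult algebra_simps sum_distrib_left sum_subtractf)
        qed
        then have "c i * (f i y - f j y) = 0"
          using insert.IH[rule_format, of "\<lambda>i. c i * (f i y - f j y)"] i by blast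
        then show ?thesis using y by simp
      qed
      then have "(\<Sum>i\<in>S. c i * f i 1) = 0" by (simp add: sum.neutral)
      then have "c j * f j 1 = 0" using c[rule_format, of 1] insert.hyps by simp
      then show "\<forall>i\<in>insert j S. c i = 0" using S0 by simp
    qed
  qed
  show ?thesis using *[of UNIV] assms by auto
qed

text \<open>The eigenvalues \<open>s a\<close> of the multiplication operators are additive in \<open>a\<close>, and \<open>m a = s a * m 1\<close>.
  Unless \<open>m = 0\<close>, the map \<open>s\<close> is therefore an embedding, of which \<open>m\<close> is a multiple.\<close>

lemma common_eigenfunctional_eq_sum_embeddings:
  assumes "additive m" and B: "qvs.span B = UNIV" and eig: "\<And>b. b \<in> B \<Longrightarrow> \<exists>s. \<forall>x. m (b * x) = s * m x"
  shows "\<exists>c. \<forall>x. m x = (\<Sum>i\<in>UNIV. c i * f i x)"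
proof -
  interpret additive m by fact
  have all: "\<exists>s. \<forall>x. m (a * x) = s * m x" for a
  proof -
    have "a \<in> qvs.span B" using B by simp
    then show ?thesis
    proof (induction rule: qvs.span_induct_alt)
      case base
      show ?case by (rule exI[of _ 0]) (simp add: zero)
    next
      case (step q b y)
      obtain s t where "\<forall>x. m (b * x) = s * m x" "\<forall>x. m (y * x) = t * m x"
        using eig step by blast
      then show ?case
        by (intro exI[of _ "of_rat q * s + t"])
          (simp add: distrib_right add mult.assoc additive_of_rat[OF assms(1)])
    qed
  qed
  then obtain s where s: "\<And>a x. m (a * x) = s a * m x" by metis
  have s1: "m a = s a * m 1" for a using s[of a 1] by simp
  show ?thesis
  proof (cases "m 1 = 0")
    case True
    then have "m x = 0" for x by (metis s1 mult_zero_right)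
    then show ?thesis by (intro exI[of _ "\<lambda>_. 0"]) simp
  next
    case False
    have "s 1 = 1" using s1[of 1] False by (metis mult_cancel_right1)
    moreover have "s (a + b) = s a + s b" for a b
      using s1[of "a + b"] s1[of a] s1[of b] False by (metis add distrib_right mult_right_cancel)
    moreover have "s (a * b) = s a * s b" for a b
      by (metis s1[of "a * b"] s[of a b] s1[of b] False mult.assoc mult_right_cancel)
    ultimately have "field_embedding s" by (simp add: field_embedding_def)
    then obtain i where i: "s = f i" using range_f by blast
    show ?thesis
    proof (intro exI allI)
      fix x
      show "m x = (\<Sum>j\<in>UNIV. (if j = i then m 1 else 0) * f j x)"
        by (subst s1, unfold i) (simp add: if_distrib[of "\<lambda>z. z * _"] cong: if_cong)
    qed
  qed
qed

text \<open>Decompose \<open>l\<close> successively under the multiplications by the elements of a finite spanning set; the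
  resulting components are common eigenfunctionals.\<close>

lemma additive_eq_sum_embeddings:
  fixes l :: "'k \<Rightarrow> complex"
  assumes "additive l"
  obtains c where "\<And>x. l x = (\<Sum>i\<in>UNIV. c i * f i x)"
proof -
  obtain B :: "'k set" where B: "finite B" "qvs.span B = UNIV" using number_field number_field_iff by blast
  have "\<exists>c. \<forall>x. l x = (\<Sum>i\<in>UNIV. c i * f i x)"
    if "finite A" "A \<subseteq> B" "additive l" "\<And>b. b \<in> B - A \<Longrightarrow> \<exists>s. \<forall>x. l (b * x) = s * l x" for A l
    using that
  proof (induction A arbitrary: l)
    case empty
    then show ?case using common_eigenfunctional_eq_sum_embeddings[OF _ B(2)] by auto
  next
    case (insert a A)
    obtain R m where m: "finite R" "\<And>x. l x = (\<Sum>r\<in>R. m r x)" "\<And>r. additive (m r)"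
      "\<And>r x. r \<in> R \<Longrightarrow> m r (a * x) = r * m r x"
      "\<And>r b s. \<forall>x. l (b * x) = s * l x \<Longrightarrow> \<forall>x. m r (b * x) = s * m r x"
      by (rule eigen_decomposition[OF number_field insert.prems(2), of a]) (rule that, assumption+)
    have "\<exists>c. \<forall>x. m r x = (\<Sum>i\<in>UNIV. c i * f i x)" if r: "r \<in> R" for r
    proof (rule insert.IH)
      fix b assume b: "b \<in> B - A"
      show "\<exists>s. \<forall>x. m r (b * x) = s * m r x"
      proof (cases "b = a")
        case True then show ?thesis using m(4)[OF r] by blast
      next
        case False
        then obtain s where "\<forall>x. l (b * x) = s * l x" using insert.prems(3)[of b] b by auto
        then show ?thesis using m(5)[of b s] by blast
      qed
    qed (use insert.prems m(3) in auto)
    then obtain c where c: "\<And>r x. r \<in> R \<Longrightarrow> m r x = (\<Sum>i\<in>UNIV. c r i * f i x)" by metis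
    show ?case
    proof (intro exI allI)
      fix x
      have "l x = (\<Sum>r\<in>R. \<Sum>i\<in>UNIV. c r i * f i x)" using m(2) c by simp
      also have "\<dots> = (\<Sum>i\<in>UNIV. (\<Sum>r\<in>R. c r i) * f i x)"
        by (subst sum.swap) (simp add: sum_distrib_right)
      finally show "l x = (\<Sum>i\<in>UNIV. (\<Sum>r\<in>R. c r i) * f i x)" .
    qed
  qed
  from this[OF B(1) order.refl assms] show ?thesis using that by blast
qed

text \<open>A family \<open>b\<close> is called nondegenerate if this matrix is invertible. By \<open>nondegenerate_unique\<close> and
  \<open>nondegenerate_spans\<close>, it is then a basis of the field over the rationals.\<close>

definition embedding_matrix :: "('n \<Rightarrow> 'k) \<Rightarrow> complex^'n^'n" where
  "embedding_matrix b = (\<chi> i j. f i (b j))"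

text \<open>Otherwise some nonzero linear map \<open>g\<close> kills all vectors of conjugates. Each row of its matrix is a linear
  relation between the embeddings, and so is zero.\<close>

lemma span_embedding_vectors: "vec.span (range (\<lambda>x. \<chi> i. f i x)) = UNIV"
proof (rule ccontr)
  let ?V = "range (\<lambda>x. \<chi> i. f i x)"
  assume "vec.span ?V \<noteq> UNIV"
  then obtain v where v: "v \<notin> vec.span ?V" by blast
  obtain B where B: "B \<subseteq> ?V" "vec.independent B" "?V \<subseteq> vec.span B"
    using vec.maximal_independent_subset[of ?V] by blast
  have v': "v \<notin> vec.span B" using v vec.span_mono[OF B(1)] by blast
  then have "vec.independent (insert v B)" using B(2) by (simp add: vec.independent_insertI)
  then obtain g :: "complex^'n \<Rightarrow> complex^'n" where g: "Vector_Spaces.linear (*s) (*s) g"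
    "\<And>x. x \<in> insert v B \<Longrightarrow> g x = (if x = v then 1 else 0)"
    using vec.linear_independent_extend[of "insert v B" "\<lambda>x. if x = v then 1 else 0"] by blast
  interpret g: Vector_Spaces.linear "(*s)" "(*s)" g by fact
  have gB: "g x = 0" if "x \<in> vec.span B" for x
    using that by (rule g.eq_0_on_span[rotated]) (use g(2) v' vec.span_base in fastforce)
  define M where "M = matrix g"
  have gM: "g x = M *v x" for x unfolding M_def by (simp add: matrix_works[OF g(1)])
  have "(\<Sum>i\<in>UNIV. M $ k $ i * f i x) = 0" for k x
  proof -
    have "g (\<chi> i. f i x) = 0" using B(3) by (intro gB) auto
    then have "(M *v (\<chi> i. f i x)) $ k = 0" by (simp add: gM)
    then show ?thesis by (simp add: matrix_vector_mult_def)
  qed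
  then have "M $ k $ i = 0" for k i by (rule dedekind_independence)
  then have "g v $ k = 0" for k by (simp add: gM matrix_vector_mult_def)
  then show False using g(2)[of v] by simp
qed

lemma exists_nondegenerate_family: "\<exists>b. det (embedding_matrix b) \<noteq> 0"
proof -
  let ?V = "range (\<lambda>x. \<chi> i. f i x)"
  obtain B where B: "B \<subseteq> ?V" "vec.independent B" "?V \<subseteq> vec.span B"
    using vec.maximal_independent_subset[of ?V] by blast
  have spB: "vec.span B = UNIV"
    using span_embedding_vectors vec.span_mono[OF B(3)] by (simp add: vec.span_span top.extremum_uniqueI)
  have fin: "finite B" using B(2) vec.finiteI_independent by blast
  have "card B = CARD('n)"
    using vec.dim_eq_card[of B UNIV] spB B(2) vec_dim_card[where 'n = 'n and 'a = complex] by simp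
  then obtain h where h: "bij_betw h (UNIV::'n set) B" using fin finite_same_card_bij[of "UNIV::'n set" B] by auto
  have "\<exists>x. h j = (\<chi> i. f i x)" for j using h B(1) by (auto simp: bij_betw_def)
  then obtain b where b: "\<And>j. h j = (\<chi> i. f i (b j))" by metis
  have "c = 0" if "embedding_matrix b *v c = 0" for c
  proof -
    let ?g = "inv_into UNIV h"
    have "(\<Sum>v\<in>B. (c $ ?g v) *s v) = (\<Sum>j\<in>UNIV. (c $ ?g (h j)) *s h j)"
      using sum.reindex_bij_betw[OF h, of "\<lambda>v. (c $ ?g v) *s v"] by simp
    also have "\<dots> = (\<Sum>j\<in>UNIV. c $ j *s h j)" using h by (simp add: bij_betw_def inv_into_f_f)
    also have "\<dots> = embedding_matrix b *v c"
      by (simp add: Finite_Cartesian_Product.vec_eq_iff matrix_vector_mult_def embedding_matrix_def b mult.commute)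
    finally have 0: "(\<Sum>v\<in>B. (c $ ?g v) *s v) = 0" using that by simp
    have "c $ j = 0" for j
    proof -
      have "c $ ?g (h j) = 0"
        using vec.independentD[OF B(2) fin order.refl 0, of "h j"] h by (auto simp: bij_betw_def)
      then show ?thesis using h by (simp add: bij_betw_def inv_into_f_f)
    qed
    then show ?thesis by (simp add: Finite_Cartesian_Product.vec_eq_iff)
  qed
  then have "invertible (embedding_matrix b)"
    by (metis matrix_left_invertible_ker invertible_left_inverse)
  then show ?thesis by (auto simp: invertible_det_nz)
qed

lemma nondegenerate_coordinates:
  assumes "det (embedding_matrix b) \<noteq> 0"
  obtains d where "\<And>i. y i = (\<Sum>j\<in>UNIV. d j * f i (b j))"
proof -
  have "invertible (embedding_matrix b)" using assms by (simp add: invertible_det_nz)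
  then obtain B where B: "embedding_matrix b ** B = mat 1" unfolding invertible_def by blast
  define z where "z = B *v (\<chi> i. y i)"
  have "embedding_matrix b *v z = (\<chi> i. y i)"
    unfolding z_def by (simp add: matrix_vector_mul_assoc B)
  from arg_cong[OF this, of "\<lambda>v. v $ i" for i] have "y i = (\<Sum>j\<in>UNIV. z $ j * f i (b j))" for i
    by (simp add: matrix_vector_mult_def embedding_matrix_def mult.commute)
  then show ?thesis using that by blast
qed

lemma nondegenerate_unique:
  assumes "det (embedding_matrix b) \<noteq> 0" "\<And>i. (\<Sum>j\<in>UNIV. d j * f i (b j)) = 0"
  shows "d j = 0"
proof -
  have "invertible (embedding_matrix b)" using assms by (simp add: invertible_det_nz)
  moreover have "embedding_matrix b *v (\<chi> j. d j) = 0"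
    unfolding Finite_Cartesian_Product.vec_eq_iff
    using assms(2) by (simp add: matrix_vector_mult_def embedding_matrix_def mult.commute)
  ultimately have "(\<chi> j. d j) = 0"
    by (metis matrix_left_invertible_ker invertible_left_inverse)
  from arg_cong[OF this, of "\<lambda>v. v $ j"] show ?thesis by simp
qed

text \<open>If \<open>x\<close> were not in the rational span of \<open>b\<close>, some additive functional would vanish on \<open>b\<close> and not at
  \<open>x\<close>. It is a combination of embeddings, and the conjugates of \<open>x\<close> are complex combinations, with
  coefficients independent of the embedding, of those of \<open>b\<close>; so it vanishes at \<open>x\<close> after all.\<close>

lemma nondegenerate_spans:
  assumes "det (embedding_matrix b) \<noteq> 0"
  obtains q :: "'n \<Rightarrow> rat" where "x = (\<Sum>j\<in>UNIV. of_rat (q j) * b j)"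
proof -
  have "x \<in> qvs.span (range b)"
  proof (rule ccontr)
    assume x: "x \<notin> qvs.span (range b)"
    obtain B where B: "B \<subseteq> range b" "qvs.independent B" "range b \<subseteq> qvs.span B"
      using qvs.maximal_independent_subset[of "range b"] by blast
    have x': "x \<notin> qvs.span B" using x qvs.span_mono[OF B(1)] by blast
    then have ind: "qvs.independent (insert x B)" using B(2) by (simp add: qvs.independent_insertI)
    interpret p: vector_space_pair "\<lambda>(q::rat) (x::'k). of_rat q * x" "\<lambda>(q::rat) (x::complex). of_rat q * x"
      by unfold_locales
    obtain g where g: "Vector_Spaces.linear (\<lambda>(q::rat) (x::'k). of_rat q * x) (\<lambda>(q::rat) (x::complex). of_rat q * x) g"
      "\<And>y. y \<in> insert x B \<Longrightarrow> g y = (if y = x then 1 else 0)"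
      using p.linear_independent_extend[OF ind, of "\<lambda>y. if y = x then 1 else 0"] by blast
    interpret g: Vector_Spaces.linear "\<lambda>(q::rat) (x::'k). of_rat q * x" "\<lambda>(q::rat) (x::complex). of_rat q * x" g by fact
    have gB: "g y = 0" if "y \<in> qvs.span B" for y
      using that by (rule g.eq_0_on_span[rotated]) (use g(2) x' qvs.span_base in fastforce)
    have "additive g" by unfold_locales (rule g.add)
    then obtain c where c: "\<And>x. g x = (\<Sum>i\<in>UNIV. c i * f i x)" using additive_eq_sum_embeddings by blast
    obtain d where d: "\<And>i. f i x = (\<Sum>j\<in>UNIV. d j * f i (b j))"
      using nondegenerate_coordinates[OF assms, of "\<lambda>i. f i x"] by blast
    have "g x = (\<Sum>i\<in>UNIV. \<Sum>j\<in>UNIV. d j * (c i * f i (b j)))"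
      by (simp add: c[of x] d sum_distrib_left mult_ac)
    also have "\<dots> = (\<Sum>j\<in>UNIV. d j * g (b j))"
      by (subst sum.swap) (simp add: c sum_distrib_left)
    also have "\<dots> = 0" using gB B(3) by (simp add: image_subset_iff)
    finally show False using g(2)[of x] by simp
  qed
  then have "\<exists>q::'n \<Rightarrow> rat. x = (\<Sum>j\<in>UNIV. of_rat (q j) * b j)"
  proof (induction rule: qvs.span_induct_alt)
    case base
    show ?case by (rule exI[of _ "\<lambda>_. 0"]) simp
  next
    case (step c y z)
    then obtain j q where "y = b j" "z = (\<Sum>j\<in>UNIV. of_rat (q j) * b j)" by blast
    then show ?case
      by (intro exI[of _ "\<lambda>i. (if i = j then c else 0) + q i"])
        (simp add: of_rat_add distrib_right sum.distrib if_distrib[of of_rat] if_distrib[of "\<lambda>z. z * _"] cong: if_cong)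
  qed
  then show ?thesis using that by blast
qed

section \<open>The norm, and a unit of infinite order\<close>

lemma f_of_nat [simp]: "f i (of_nat n) = of_nat n"
  by (metis f.hom_of_int of_int_of_nat_eq)

lemma exists_algebraic_int_multiple:
  obtains N :: int where "N \<noteq> 0" "algebraic_int (of_int N * (x::'k))"
proof -
  obtain p :: "rat poly" where p: "p \<noteq> 0" "poly (map_poly of_rat p) x = 0"
    using number_field_algebraic[OF number_field] by blast
  have "algebraic x"
    by (rule algebraicI'[of "map_poly of_rat p"]) (use p in auto)
  then show ?thesis using algebraicE' algebraic_imp_algebraic_int_multiple that by metis
qed

lemma f_algebraic_int_iff [simp]: "algebraic_int (f i x) \<longleftrightarrow> algebraic_int x"
proof -
  have "poly (map_poly of_int p) (f i x) = f i (poly (map_poly of_int p) x)" for p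
    by (simp add: poly_altdef f.hom_sum f.hom_mult f.hom_power f.hom_of_int)
  then show ?thesis by (simp add: algebraic_int_altdef_ipoly)
qed

text \<open>Nonzero integer multiples of the members of a nondegenerate family are integral and still nondegenerate.\<close>

lemma exists_integral_basis:
  obtains b where "\<And>j. algebraic_int (b j)" "det (embedding_matrix b) \<noteq> 0"
proof -
  obtain b where b: "det (embedding_matrix b) \<noteq> 0" using exists_nondegenerate_family by blast
  have "\<forall>j. \<exists>N::int. N \<noteq> 0 \<and> algebraic_int (of_int N * b j)" by (metis exists_algebraic_int_multiple)
  then obtain N :: "'n \<Rightarrow> int" where N: "\<And>j. N j \<noteq> 0" "\<And>j. algebraic_int (of_int (N j) * b j)" by metis
  let ?b = "\<lambda>j. of_int (N j) * b j"
  have "c = 0" if "embedding_matrix ?b *v c = 0" for c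
  proof -
    have "c $ j * of_int (N j) = 0" for j
    proof (rule nondegenerate_unique[OF b, of "\<lambda>j. c $ j * of_int (N j)"])
      fix i
      have "(embedding_matrix ?b *v c) $ i = 0" using that by simp
      then show "(\<Sum>j\<in>UNIV. c $ j * of_int (N j) * f i (b j)) = 0"
        by (simp add: embedding_matrix_def matrix_vector_mult_def f.hom_mult f.hom_of_int mult_ac)
    qed
    then show ?thesis using N(1) by (simp add: Finite_Cartesian_Product.vec_eq_iff)
  qed
  then have "invertible (embedding_matrix ?b)"
    by (metis matrix_left_invertible_ker invertible_left_inverse)
  then show ?thesis using that[of ?b] N(2) by (simp add: invertible_det_nz)
qed

definition field_norm :: "'k \<Rightarrow> complex" where "field_norm a = (\<Prod>i\<in>UNIV. f i a)"

lemma field_norm_mult: "field_norm (a * b) = field_norm a * field_norm b"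
  by (simp add: field_norm_def f.hom_mult prod.distrib)

lemma field_norm_1: "field_norm 1 = 1" by (simp add: field_norm_def)

lemma field_norm_eq_0_iff: "field_norm a = 0 \<longleftrightarrow> a = 0"
  by (auto simp: field_norm_def prod_zero_iff)

text \<open>In a basis \<open>b\<close>, multiplication by \<open>a\<close> has a rational matrix \<open>Q\<close>. With \<open>E\<close> the matrix of conjugates of
  \<open>b\<close>, the equations for \<open>a * b j\<close> say that \<open>diag (f i a) E = E Q\<close>; so the norm is \<open>det Q\<close>.\<close>

lemma field_norm_rational: "field_norm a \<in> \<rat>"
proof -
  obtain b where b: "det (embedding_matrix b) \<noteq> 0" using exists_nondegenerate_family by blast
  have "\<forall>j. \<exists>q::'n \<Rightarrow> rat. a * b j = (\<Sum>k\<in>UNIV. of_rat (q k) * b k)"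
    by (metis nondegenerate_spans[OF b])
  then obtain q :: "'n \<Rightarrow> 'n \<Rightarrow> rat" where q: "\<And>j. a * b j = (\<Sum>k\<in>UNIV. of_rat (q j k) * b k)" by metis
  define Q :: "complex^'n^'n" where "Q = (\<chi> k j. of_rat (q j k))"
  have "f i a * f i (b j) = (\<Sum>k\<in>UNIV. f i (b k) * of_rat (q j k))" for i j
    using arg_cong[OF q[of j], of "f i"] by (simp add: f.hom_mult f.hom_sum mult.commute)
  then have "(\<chi> i. f i a *s (embedding_matrix b $ i)) = embedding_matrix b ** Q"
    by (simp add: Finite_Cartesian_Product.vec_eq_iff embedding_matrix_def matrix_matrix_mult_def Q_def)
  then have "det (\<chi> i. f i a *s (embedding_matrix b $ i)) = det (embedding_matrix b) * det Q"
    by (simp add: det_mul)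
  moreover have "det (\<chi> i. f i a *s (embedding_matrix b $ i)) = field_norm a * det (\<chi> i. embedding_matrix b $ i)"
    unfolding field_norm_def using Determinants.det_rows_mul[of "\<lambda>i. f i a" "\<lambda>i. embedding_matrix b $ i"] by simp
  ultimately have "field_norm a * det (embedding_matrix b) = det (embedding_matrix b) * det Q"
    by simp
  then have "field_norm a = det Q" using b by simp
  moreover have "det Q \<in> \<rat>"
    unfolding Determinants.det_def Q_def
    by (intro Rats_sum Rats_mult Rats_prod) auto
  ultimately show ?thesis by simp
qed

lemma field_norm_integer: "algebraic_int a \<Longrightarrow> field_norm a \<in> \<int>"
  by (rule rational_algebraic_int_is_int[OF _ field_norm_rational])
    (auto simp: field_norm_def intro: algebraic_int_prod)

lemma field_norm_ge_1:
  assumes "algebraic_int a" "a \<noteq> 0" shows "norm (field_norm a) \<ge> 1"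
proof -
  obtain z :: int where z: "field_norm a = of_int z" using field_norm_integer[OF assms(1)] by (auto simp: Ints_def)
  then have "z \<noteq> 0" using assms(2) field_norm_eq_0_iff[of a] by auto
  then show ?thesis unfolding z by simp
qed

lemma integer_eq_0_if_norm_small:
  assumes "algebraic_int a" "(\<Prod>i\<in>UNIV. norm (f i a)) < 1" shows "a = 0"
  using field_norm_ge_1[OF assms(1)] assms(2) by (auto simp: field_norm_def prod_norm)

lemma integer_eq_0_if_conjugates_small:
  assumes "algebraic_int a" "\<And>i. norm (f i a) < 1" shows "a = 0"
proof (rule integer_eq_0_if_norm_small[OF assms(1)])
  have "(\<Prod>i\<in>(UNIV::'n set). norm (f i a)) < (\<Prod>i\<in>(UNIV::'n set). 1)"
    by (rule prod_mono_strict) (use assms(2) in \<open>auto intro: less_imp_le\<close>)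
  then show "(\<Prod>i\<in>UNIV. norm (f i a)) < 1" by simp
qed

text \<open>Under one embedding, \<open>field_norm a / a\<close> is the product of the remaining conjugates of \<open>a\<close>, and integrality can be
  tested under an embedding.\<close>

lemma algebraic_int_field_norm_div:
  assumes "algebraic_int a" "a \<noteq> 0" "field_norm a = of_int z"
  shows "algebraic_int (of_int z / a)"
proof -
  obtain i0 :: 'n where True by blast
  have "f i0 (of_int z / a) = field_norm a / f i0 a" using assms by (simp add: f.hom_div f.hom_of_int)
  also have "field_norm a = f i0 a * (\<Prod>i\<in>UNIV-{i0}. f i a)"
    unfolding field_norm_def by (rule prod.remove) auto
  also have "f i0 a * (\<Prod>i\<in>UNIV-{i0}. f i a) / f i0 a = (\<Prod>i\<in>UNIV-{i0}. f i a)"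
    using assms by simp
  also have "algebraic_int \<dots>" using assms by (intro algebraic_int_prod) simp
  finally show ?thesis by simp
qed

text \<open>Rounding the coordinates down changes every conjugate by at most the sum of the absolute values of all
  conjugates of \<open>b\<close>, independently of the point.\<close>

lemma round_to_integral_combination:
  "\<exists>C>0. \<forall>d :: 'n \<Rightarrow> real. \<exists>z :: 'n \<Rightarrow> int. \<forall>i.
     norm ((\<Sum>j\<in>UNIV. of_real (d j) * f i (b j)) - f i (\<Sum>j\<in>UNIV. of_int (z j) * b j)) \<le> C"
proof -
  define C where "C = 1 + (\<Sum>j\<in>UNIV. \<Sum>i\<in>UNIV. norm (f i (b j)))"
  have "C > 0" unfolding C_def by (intro add_pos_nonneg sum_nonneg) auto
  have *: "norm ((\<Sum>j\<in>UNIV. of_real (d j) * f i (b j)) - f i (\<Sum>j\<in>UNIV. of_int \<lfloor>d j\<rfloor> * b j)) \<le> C"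
    for d :: "'n \<Rightarrow> real" and i
  proof -
    have "(\<Sum>j\<in>UNIV. of_real (d j) * f i (b j)) - f i (\<Sum>j\<in>UNIV. of_int \<lfloor>d j\<rfloor> * b j)
        = (\<Sum>j\<in>UNIV. of_real (frac (d j)) * f i (b j))"
      by (simp add: f.hom_sum f.hom_mult f.hom_of_int sum_subtractf[symmetric] frac_def algebra_simps)
    also have "norm \<dots> \<le> (\<Sum>j\<in>UNIV. norm (f i (b j)))"
    proof (rule sum_norm_le)
      fix j
      have "frac (d j) * norm (f i (b j)) \<le> 1 * norm (f i (b j))"
        by (rule mult_right_mono) (auto intro: less_imp_le frac_lt_1)
      then show "norm (of_real (frac (d j)) * f i (b j)) \<le> norm (f i (b j))"
        by (simp add: norm_mult)
    qed
    also have "\<dots> \<le> (\<Sum>j\<in>UNIV. \<Sum>i\<in>UNIV. norm (f i (b j)))"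
      by (intro sum_mono member_le_sum) auto
    finally show ?thesis by (simp add: C_def)
  qed
  show ?thesis
  proof (intro exI[of _ C] conjI allI)
    fix d :: "'n \<Rightarrow> real"
    show "\<exists>z :: 'n \<Rightarrow> int. \<forall>i.
     norm ((\<Sum>j\<in>UNIV. of_real (d j) * f i (b j)) - f i (\<Sum>j\<in>UNIV. of_int (z j) * b j)) \<le> C"
      by (rule exI[of _ "\<lambda>j. \<lfloor>d j\<rfloor>"]) (rule allI, rule *)
  qed fact
qed

text \<open>The vectors of conjugates of two different integers are at distance at least 1, by
  \<open>integer_eq_0_if_conjugates_small\<close>, and a bounded infinite set would have a limit point.\<close>

lemma finite_bounded_conjugates:
  "finite {a. algebraic_int a \<and> (\<forall>i. norm (f i a) \<le> C)}" (is "finite ?A")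
proof (rule ccontr)
  assume inf: "infinite ?A"
  let ?v = "\<lambda>a. \<chi> i. f i a"
  have inj: "inj ?v" by (rule injI) (simp add: Finite_Cartesian_Product.vec_eq_iff)
  then have "infinite (?v ` ?A)" using inf by (simp add: finite_image_iff inj_on_subset)
  moreover have "bounded (?v ` ?A)"
    unfolding bounded_iff
  proof (intro exI ballI)
    fix x assume "x \<in> ?v ` ?A"
    then obtain a where a: "a \<in> ?A" "x = ?v a" by blast
    have "norm x \<le> (\<Sum>i\<in>UNIV. norm (x $ i))" unfolding norm_vec_def by (rule L2_set_le_sum) auto
    also have "\<dots> \<le> (\<Sum>i\<in>(UNIV::'n set). C)" using a by (intro sum_mono) auto
    finally show "norm x \<le> (\<Sum>i\<in>(UNIV::'n set). C)" .
  qed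
  ultimately obtain x where "x islimpt (?v ` ?A)" using bounded_infinite_imp_islimpt by blast
  then have inf2: "infinite (?v ` ?A \<inter> ball x (1/2))" by (simp add: islimpt_eq_infinite_ball)
  then obtain y where y: "y \<in> ?v ` ?A \<inter> ball x (1/2)" using infinite_imp_nonempty by blast
  obtain z where z: "z \<in> (?v ` ?A \<inter> ball x (1/2)) - {y}"
    using infinite_imp_nonempty[OF infinite_remove[OF inf2, of y]] by blast
  have yz: "y \<in> ?v ` ?A \<inter> ball x (1/2)" "z \<in> ?v ` ?A \<inter> ball x (1/2)" "y \<noteq> z"
    using y z by blast+
  then obtain a c where ac: "a \<in> ?A" "y = ?v a" "c \<in> ?A" "z = ?v c" by blast
  have "dist y z < 1/2 + 1/2"
    by (rule dist_triangle_half_l[of _ x]) (use yz in \<open>auto simp: dist_commute\<close>)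
  then have d: "norm (y - z) < 1" by (simp add: dist_norm)
  have "a - c = 0"
  proof (rule integer_eq_0_if_conjugates_small)
    show "algebraic_int (a - c)" using ac by (auto intro: algebraic_int_diff)
    fix i
    have "norm ((y - z) $ i) \<le> norm (y - z)" by (rule Finite_Cartesian_Product.norm_nth_le)
    then show "norm (f i (a - c)) < 1" using d ac by (simp add: f.hom_minus)
  qed
  then show False using yz ac by simp
qed

text \<open>Congruence modulo \<open>k\<close> has finitely many classes on the integers of the field: \<open>\<rho>\<close> picks a
  representative with bounded conjugates.\<close>

lemma finite_residues:
  fixes k :: int
  assumes "k \<noteq> 0"
  obtains \<rho> :: "'k \<Rightarrow> 'k" where "finite (\<rho> ` {a. algebraic_int a})"
    "\<And>a. algebraic_int a \<Longrightarrow> \<exists>g. algebraic_int g \<and> a - \<rho> a = of_int k * g"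
proof -
  obtain b where b: "\<And>j. algebraic_int (b j)" "det (embedding_matrix b) \<noteq> 0"
    using exists_integral_basis by blast
  obtain C where C: "C > 0" "\<And>d :: 'n \<Rightarrow> real. \<exists>z :: 'n \<Rightarrow> int. \<forall>i.
     norm ((\<Sum>j\<in>UNIV. of_real (d j) * f i (b j)) - f i (\<Sum>j\<in>UNIV. of_int (z j) * b j)) \<le> C"
    using round_to_integral_combination[of b] by blast
  \<comment> \<open>The quotient \<open>a / k\<close> is rounded to an integer \<open>g\<close>, and \<open>a - k g\<close> is the representative.\<close>
  let ?C = "\<bar>of_int k\<bar> * C"
  have ex: "\<exists>r. algebraic_int r \<and> (\<forall>i. norm (f i r) \<le> ?C) \<and> (\<exists>g. algebraic_int g \<and> a - r = of_int k * g)"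
    if a: "algebraic_int a" for a
  proof -
    obtain q :: "'n \<Rightarrow> rat" where q: "a / of_int k = (\<Sum>j\<in>UNIV. of_rat (q j) * b j)"
      using nondegenerate_spans[OF b(2)] by blast
    have q': "f i (a / of_int k) = (\<Sum>j\<in>UNIV. of_real (of_rat (q j)) * f i (b j))" for i
      unfolding q by (simp add: f.hom_sum f.hom_mult of_real_of_rat)
    obtain z :: "'n \<Rightarrow> int"
      where z: "\<And>i. norm (f i (a / of_int k) - f i (\<Sum>j\<in>UNIV. of_int (z j) * b j)) \<le> C"
      using C(2)[of "\<lambda>j. of_rat (q j)"] unfolding q' by blast
    define g where "g = (\<Sum>j\<in>UNIV. of_int (z j) * b j)"
    have g: "algebraic_int g" unfolding g_def using b by (intro algebraic_int_sum algebraic_int_mult) auto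
    have "norm (f i (a - of_int k * g)) \<le> ?C" for i
    proof -
      have "f i (a - of_int k * g) = of_int k * (f i (a / of_int k) - f i g)"
        using assms by (simp add: f.hom_minus f.hom_mult f.hom_div f.hom_of_int algebra_simps)
      then show ?thesis using z[of i] by (simp add: norm_mult g_def mult_left_mono)
    qed
    then show ?thesis using g a
      by (intro exI[of _ "a - of_int k * g"]) (auto intro: algebraic_int_diff algebraic_int_mult)
  qed
  define \<rho> where "\<rho> = (\<lambda>a. SOME r. algebraic_int r \<and> (\<forall>i. norm (f i r) \<le> ?C) \<and>
      (\<exists>g. algebraic_int g \<and> a - r = of_int k * g))"
  have \<rho>: "algebraic_int (\<rho> a) \<and> (\<forall>i. norm (f i (\<rho> a)) \<le> ?C) \<and>
      (\<exists>g. algebraic_int g \<and> a - \<rho> a = of_int k * g)" if "algebraic_int a" for a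
    unfolding \<rho>_def by (rule someI_ex) (rule ex[OF that])
  show ?thesis
  proof (rule that[of \<rho>])
    show "finite (\<rho> ` {a. algebraic_int a})"
      by (rule finite_subset[OF _ finite_bounded_conjugates[of ?C]]) (use \<rho> in auto)
  qed (use \<rho> in blast)
qed

text \<open>Minkowski's argument by the pigeonhole principle, with \<open>n\<close> the degree: the \<open>(M + 1) ^ n\<close> combinations of an integral
  basis with coefficients in \<open>{0..M}\<close> have real conjugates \<open>f i0\<close> in an interval of length proportional to
  \<open>M\<close>. Divide it into \<open>M ^ n\<close> cells. Two combinations share a cell; in their difference, the conjugate \<open>f i0\<close> is of
  order \<open>M / M ^ n\<close> and the others of order \<open>M\<close>, so that the norm is bounded independently of \<open>M\<close>.\<close>

lemma exists_integer_small_conjugate: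
  assumes real: "\<And>x. f i0 x \<in> \<real>" and n: "CARD('n) \<ge> 2"
  obtains C where "\<And>\<epsilon>. \<epsilon> > 0 \<Longrightarrow> \<exists>a. algebraic_int a \<and> a \<noteq> 0 \<and> norm (f i0 a) < \<epsilon> \<and> norm (field_norm a) \<le> C"
proof -
  obtain b where b: "\<And>j. algebraic_int (b j)" "det (embedding_matrix b) \<noteq> 0"
    using exists_integral_basis by blast
  \<comment> \<open>The summand 1 makes the conjugates of the combinations strictly smaller than \<open>M * B\<close>, so that
    \<open>M ^ n\<close> cells of length \<open>w\<close> suffice.\<close>
  define B where "B = 1 + (\<Sum>j\<in>UNIV. \<Sum>i\<in>UNIV. norm (f i (b j)))"
  have B1: "B \<ge> 1" unfolding B_def by (simp add: sum_nonneg)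
  let ?n = "CARD('n)"
  have bound: "norm (\<Sum>j\<in>UNIV. of_int (z j) * f i (b j)) \<le> real M * (B - 1)"
    if "\<And>j. \<bar>z j\<bar> \<le> int M" for z M i
  proof -
    have "norm (\<Sum>j\<in>UNIV. of_int (z j) * f i (b j)) \<le> (\<Sum>j\<in>UNIV. real M * norm (f i (b j)))"
    proof (rule sum_norm_le)
      fix j
      have "\<bar>real_of_int (z j)\<bar> \<le> real M" using that[of j] by linarith
      then show "norm (of_int (z j) * f i (b j)) \<le> real M * norm (f i (b j))"
        by (simp add: norm_mult mult_right_mono)
    qed
    also have "\<dots> \<le> (\<Sum>j\<in>UNIV. real M * (\<Sum>i\<in>UNIV. norm (f i (b j))))"
      by (intro sum_mono mult_left_mono member_le_sum) auto
    finally show ?thesis by (simp add: B_def sum_distrib_left)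
  qed
  have key: "\<exists>a. algebraic_int a \<and> a \<noteq> 0 \<and> norm (f i0 a) \<le> 2 * B / M \<and> norm (field_norm a) \<le> 2 * B ^ ?n"
    if M: "M \<ge> 1" for M :: nat
  proof -
    define S where "S = PiE (UNIV::'n set) (\<lambda>_. {..M})"
    define A where "A = (\<lambda>m::'n \<Rightarrow> nat. \<Sum>j\<in>UNIV. of_nat (m j) * b j)"
    define r where "r = (\<lambda>m. Re (f i0 (A m)))"
    define w where "w = 2 * real M * B / real M ^ ?n"
    have w: "w > 0" using M B1 by (simp add: w_def)
    define cell where "cell = (\<lambda>m. nat \<lfloor>(r m + real M * B) / w\<rfloor>)"
    have r_eq: "f i0 (A m) = of_real (r m)" for m using real[of "A m"] by (simp add: r_def)
    have r_bound: "\<bar>r m\<bar> < real M * B" if "m \<in> S" for m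
    proof -
      have "norm (f i0 (A m)) \<le> real M * (B - 1)"
        using bound[of "\<lambda>j. int (m j)" M i0] \<open>m \<in> S\<close>
        by (auto simp: A_def f.hom_sum f.hom_mult f.hom_of_int S_def PiE_def Pi_def)
      also have "\<dots> < real M * B" using M by simp
      finally show ?thesis by (simp add: r_eq)
    qed
    have cell_less: "cell m < M ^ ?n" if "m \<in> S" for m
    proof -
      have "(r m + real M * B) / w < (2 * real M * B) / w"
        using r_bound[OF that] w by (intro divide_strict_right_mono) (auto simp: abs_less_iff algebra_simps)
      also have "\<dots> = real M ^ ?n" using M B1 by (simp add: w_def)
      finally have "\<lfloor>(r m + real M * B) / w\<rfloor> < int (M ^ ?n)" by (simp add: floor_less_iff)
      moreover have "nat x < K" if "x < int K" "K > 0" for x K using that by linarith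
      ultimately show ?thesis using M by (simp only: cell_def) simp
    qed
    have cardS: "card S = (M + 1) ^ ?n" by (simp add: S_def card_PiE)
    have "card (cell ` S) \<le> card {..<M ^ ?n}"
      by (rule card_mono) (use cell_less in auto)
    also have "\<dots> < card S" using cardS by (simp add: power_strict_mono)
    finally have "\<not> inj_on cell S" by (metis card_image less_irrefl)
    then obtain m m' where m: "m \<in> S" "m' \<in> S" "m \<noteq> m'" "cell m = cell m'" by (auto simp: inj_on_def)
    define z where "z = (\<lambda>j. int (m j) - int (m' j))"
    define a where "a = A m - A m'"
    have a_eq: "a = (\<Sum>j\<in>UNIV. of_int (z j) * b j)"
      by (simp add: a_def A_def z_def sum_subtractf[symmetric] algebra_simps)
    have fa: "f i a = (\<Sum>j\<in>UNIV. of_int (z j) * f i (b j))" for i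
      by (simp add: a_eq f.hom_sum f.hom_mult f.hom_of_int)
    have alg: "algebraic_int a" unfolding a_eq using b by (intro algebraic_int_sum algebraic_int_mult) auto
    have a0: "a \<noteq> 0"
    proof
      assume "a = 0"
      then have "(\<Sum>j\<in>UNIV. of_int (z j) * f i (b j)) = 0" for i using fa[of i] by simp
      from nondegenerate_unique[OF b(2), of "\<lambda>j. of_int (z j)", OF this] have "z j = 0" for j by simp
      then show False using m(3) by (auto simp: z_def)
    qed
    have "\<bar>z j\<bar> \<le> int M" for j
    proof -
      have "m j \<le> M" "m' j \<le> M" using m(1,2) by (auto simp: S_def PiE_def Pi_def)
      then show ?thesis by (simp add: z_def abs_le_iff)
    qed
    from bound[OF this] have "norm (f i a) \<le> real M * (B - 1)" for i by (simp add: fa)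
    also have "real M * (B - 1) \<le> real M * B" by (simp add: mult_left_mono)
    finally have fb: "norm (f i a) \<le> real M * B" for i .
    have "\<bar>(r m + real M * B) / w - (r m' + real M * B) / w\<bar> < 1"
    proof -
      have "(r m + real M * B) / w \<ge> 0" "(r m' + real M * B) / w \<ge> 0"
        using r_bound[OF m(1)] r_bound[OF m(2)] w by auto
      then have "\<lfloor>(r m + real M * B) / w\<rfloor> = \<lfloor>(r m' + real M * B) / w\<rfloor>"
        using m(4) by (simp add: cell_def eq_nat_nat_iff)
      then show ?thesis by linarith
    qed
    then have "\<bar>(r m - r m') / w\<bar> < 1" by (simp add: diff_divide_distrib add_divide_distrib)
    then have "\<bar>r m - r m'\<bar> < w" using w by (simp add: abs_divide)
    then have fi0: "norm (f i0 a) \<le> w"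
      by (simp add: a_def f.hom_minus r_eq flip: of_real_diff)
    have "w \<le> 2 * B / M"
    proof -
      have "real M ^ 2 \<le> real M ^ ?n" using M n by (intro power_increasing) auto
      then have "w \<le> 2 * real M * B / real M ^ 2"
        unfolding w_def using M B1 by (intro divide_left_mono) auto
      also have "\<dots> = 2 * B / M" using M by (simp add: power2_eq_square)
      finally show ?thesis .
    qed
    moreover have "norm (field_norm a) \<le> 2 * B ^ ?n"
    proof -
      have "norm (field_norm a) = norm (f i0 a) * (\<Prod>i\<in>UNIV-{i0}. norm (f i a))"
        by (simp add: field_norm_def prod.remove[of UNIV i0] norm_mult prod_norm)
      also have "\<dots> \<le> w * (\<Prod>i\<in>UNIV-{i0}. real M * B)"
        using fi0 fb w by (intro mult_mono prod_mono prod_nonneg) auto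
      also have "\<dots> = w * (real M * B) ^ (?n - 1)" by (simp add: card_Diff_singleton)
      also have "\<dots> = 2 * ((real M * B) * (real M * B) ^ (?n - 1)) / real M ^ ?n"
        by (simp add: w_def)
      also have "(real M * B) * (real M * B) ^ (?n - 1) = (real M * B) ^ ?n"
        using n by (metis power_minus_mult mult.commute zero_less_card_finite)
      also have "2 * (real M * B) ^ ?n / real M ^ ?n = 2 * B ^ ?n"
        using M by (simp add: power_mult_distrib)
      finally show ?thesis .
    qed
    ultimately show ?thesis using alg a0 fi0 by (intro exI[of _ a]) auto
  qed
  show ?thesis
  proof (rule that[of "2 * B ^ ?n"])
    fix \<epsilon> :: real assume e: "\<epsilon> > 0"
    obtain M :: nat where M: "2 * B / \<epsilon> < real M" using reals_Archimedean2 by blast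
    have "0 < 2 * B / \<epsilon>" using B1 e by simp
    then have M1: "M \<ge> 1" using M by (metis One_nat_def Suc_leI less_trans of_nat_0_less_iff)
    have "2 * B / M < \<epsilon>" using M M1 e by (simp add: field_simps)
    then show "\<exists>a. algebraic_int a \<and> a \<noteq> 0 \<and> norm (f i0 a) < \<epsilon> \<and> norm (field_norm a) \<le> 2 * B ^ ?n"
      using key[OF M1] by (meson le_less_trans)
  qed
qed

text \<open>The integers \<open>a\<close> of norm at most \<open>C\<close> have infinitely many absolute values at the place \<open>i0\<close>, since
  they can be arbitrarily small there. They all divide a fixed integer \<open>k\<close>, the factorial of the bound for
  their norms. If two of them are congruent modulo \<open>k\<close>, then each divides the other, so their quotient is a
  unit; as there are finitely many classes, the two can be chosen to have different absolute values at
  \<open>i0\<close>.\<close>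

lemma exists_unit_not_norm_1:
  assumes real: "\<And>x. f i0 x \<in> \<real>" and n: "CARD('n) \<ge> 2"
  obtains u where "u \<in> integral_units" "norm (f i0 u) \<noteq> 1"
proof -
  obtain C where C: "\<And>\<epsilon>. \<epsilon> > 0 \<Longrightarrow> \<exists>a. algebraic_int a \<and> a \<noteq> 0 \<and> norm (f i0 a) < \<epsilon> \<and> norm (field_norm a) \<le> C"
    by (rule exists_integer_small_conjugate[OF assms]) blast
  define A where "A = {a. algebraic_int a \<and> a \<noteq> 0 \<and> norm (field_norm a) \<le> C}"
  define k :: int where "k = fact (nat \<lfloor>C\<rfloor>)"
  have k0: "k \<noteq> 0" by (simp add: k_def)
  have div: "algebraic_int (of_int k / a)" if a: "a \<in> A" for a
  proof -
    have alg: "algebraic_int a" "a \<noteq> 0" "norm (field_norm a) \<le> C" using a by (auto simp: A_def)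
    obtain z :: int where z: "field_norm a = of_int z" using field_norm_integer[OF alg(1)] by (auto simp: Ints_def)
    have "1 \<le> nat \<bar>z\<bar>" using field_norm_ge_1[OF alg(1,2)] by (simp add: z)
    moreover have "nat \<bar>z\<bar> \<le> nat \<lfloor>C\<rfloor>" using alg(3) by (simp add: z le_floor_iff nat_mono)
    ultimately have "nat \<bar>z\<bar> dvd fact (nat \<lfloor>C\<rfloor>)" by (rule dvd_fact)
    then have "int (nat \<bar>z\<bar>) dvd int (fact (nat \<lfloor>C\<rfloor>))" by (simp only: int_dvd_int_iff)
    then have "z dvd k" by (simp add: k_def)
    then obtain c where "k = z * c" by blast
    then have "of_int k / a = of_int c * (of_int z / a)" by simp
    also have "algebraic_int \<dots>"
      using algebraic_int_field_norm_div[OF alg(1,2) z] by (intro algebraic_int_mult) auto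
    finally show ?thesis .
  qed
  obtain \<rho> :: "'k \<Rightarrow> 'k" where \<rho>: "finite (\<rho> ` {a. algebraic_int a})"
    "\<And>a. algebraic_int a \<Longrightarrow> \<exists>g. algebraic_int g \<and> a - \<rho> a = of_int k * g"
    by (rule finite_residues[OF k0]) (rule that; assumption)
  define V where "V = (\<lambda>a. norm (f i0 a)) ` A"
  have "infinite V"
  proof
    assume fin: "finite V"
    have ne: "V \<noteq> {}" using C[of 1] by (auto simp: V_def A_def)
    have "Min V > 0" using fin ne by (auto simp: V_def A_def)
    then obtain a where "a \<in> A" "norm (f i0 a) < Min V" using C[of "Min V"] by (auto simp: A_def)
    then show False using Min_le[OF fin, of "norm (f i0 a)"] by (auto simp: V_def)
  qed
  \<comment> \<open>One element of \<open>A\<close> for each absolute value, so that two different ones give different absolute values.\<close>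
  define g where "g = inv_into A (\<lambda>a. norm (f i0 a))"
  have g: "g v \<in> A" "norm (f i0 (g v)) = v" if "v \<in> V" for v
    using that unfolding g_def V_def by (auto intro: inv_into_into f_inv_into_f)
  have "finite ((\<lambda>v. \<rho> (g v)) ` V)"
    by (rule finite_subset[OF _ \<rho>(1)]) (use g(1) in \<open>auto simp: A_def\<close>)
  then obtain v0 where v0: "v0 \<in> V" "infinite {v \<in> V. \<rho> (g v) = \<rho> (g v0)}"
    using pigeonhole_infinite[OF \<open>infinite V\<close>] by blast
  obtain v where v: "v \<in> V" "\<rho> (g v) = \<rho> (g v0)" "v \<noteq> v0"
  proof -
    have "\<not> {v \<in> V. \<rho> (g v) = \<rho> (g v0)} \<subseteq> {v0}" using v0(2) finite_subset by blast
    then show ?thesis using that by blast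
  qed
  have quot: "algebraic_int (a / c)" if ac: "a \<in> A" "c \<in> A" "\<rho> a = \<rho> c" for a c
  proof -
    obtain g g' where g: "algebraic_int g" "a - \<rho> a = of_int k * g" "algebraic_int g'" "c - \<rho> c = of_int k * g'"
      using \<rho>(2) ac unfolding A_def by blast
    have "a - c = of_int k * (g - g')" using g ac by (simp add: algebra_simps)
    moreover have "c \<noteq> 0" using ac by (simp add: A_def)
    ultimately have "a / c = 1 + (of_int k / c) * (g - g')" by (simp add: field_simps)
    also have "algebraic_int \<dots>" using g div[OF ac(2)]
      by (intro algebraic_int_add algebraic_int_mult algebraic_int_diff) auto
    finally show ?thesis .
  qed
  define u where "u = g v / g v0"
  have A: "g v \<in> A" "g v0 \<in> A" using g v v0 by auto
  show ?thesis
  proof (rule that[of u])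
    show "u \<in> integral_units"
      using quot[OF A v(2)] quot[OF A(2,1) v(2)[symmetric]] A
      by (auto simp: u_def integral_units_def ring_of_integers_def A_def)
    show "norm (f i0 u) \<noteq> 1"
      using g(2)[OF v(1)] g(2)[OF v0(1)] v(3) A by (auto simp: u_def f.hom_div norm_divide A_def)
  qed
qed

end

section \<open>Primitives of closed one-forms, and fields with positive curl\<close>

text \<open>Poincare's lemma on a convex set: \<open>f x\<close> is the integral of \<open>\<alpha>\<close> along the segment from a base point \<open>x0\<close> to
  \<open>x\<close>. Differentiating under the integral sign in direction \<open>v\<close> gives, by closedness, the integral of the derivative of
  \<open>t * \<alpha> (x0 + t (x - x0)) v\<close> in \<open>t\<close>. Here \<open>D v x u\<close> is the derivative of \<open>\<alpha> x v\<close> in direction \<open>u\<close>.\<close>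

lemma closed_one_form_has_primitive:
  fixes \<alpha> :: "'a::euclidean_space \<Rightarrow> 'a \<Rightarrow> real" and D :: "'a \<Rightarrow> 'a \<Rightarrow> 'a \<Rightarrow> real"
  assumes S: "open S" "convex S"
    and lin: "\<And>x. x \<in> S \<Longrightarrow> linear (\<alpha> x)"
    and D: "\<And>x v. x \<in> S \<Longrightarrow> ((\<lambda>y. \<alpha> y v) has_derivative D v x) (at x)"
    and cont: "\<And>u v. continuous_on S (\<lambda>x. D v x u)"
    and closed: "\<And>x u v. x \<in> S \<Longrightarrow> D v x u = D u x v"
  obtains f where "\<And>x. x \<in> S \<Longrightarrow> (f has_derivative \<alpha> x) (at x)"
proof (cases "S = {}")
  case True
  then show ?thesis using that by auto
next
  case False
  then obtain x0 where x0: "x0 \<in> S" by blast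
  define \<gamma> where "\<gamma> = (\<lambda>x (t::real). x0 + t *\<^sub>R (x - x0))"
  have \<gamma>S: "\<gamma> x t \<in> S" if "x \<in> S" "t \<in> {0..1}" for x t
  proof -
    have "\<gamma> x t = (1 - t) *\<^sub>R x0 + t *\<^sub>R x" by (simp add: \<gamma>_def algebra_simps)
    then show ?thesis using convexD[OF S(2) x0 that(1), of "1 - t" t] that(2) by simp
  qed
  define F where "F = (\<lambda>x t. \<alpha> (\<gamma> x t) (x - x0))"
  define G where "G = (\<lambda>x t v. \<alpha> (\<gamma> x t) v + t * D v (\<gamma> x t) (x - x0))"
  have \<alpha>_sum: "\<alpha> y w = (\<Sum>b\<in>Basis. (w \<bullet> b) * \<alpha> y b)" if "y \<in> S" for y w
  proof -
    interpret linear "\<alpha> y" by (rule lin[OF that])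
    have "\<alpha> y w = \<alpha> y (\<Sum>b\<in>Basis. (w \<bullet> b) *\<^sub>R b)" by (simp add: euclidean_representation)
    then show ?thesis by (simp add: sum scale)
  qed
  have linD: "linear (D v y)" if "y \<in> S" for v y
    using D[OF that] has_derivative_linear by blast
  have D_sum: "D v y w = (\<Sum>b\<in>Basis. (w \<bullet> b) * D b y v)" if "y \<in> S" for v y w
  proof -
    interpret linear "D v y" by (rule linD[OF that])
    have "D v y w = D v y (\<Sum>b\<in>Basis. (w \<bullet> b) *\<^sub>R b)" by (simp add: euclidean_representation)
    also have "\<dots> = (\<Sum>b\<in>Basis. (w \<bullet> b) * D v y b)" by (simp add: sum scale)
    finally show ?thesis using closed[OF that] by simp
  qed
  have G_sum: "G x t v = (\<Sum>b\<in>Basis. (v \<bullet> b) * \<alpha> (\<gamma> x t) b + ((x - x0) \<bullet> b) * (t * D b (\<gamma> x t) v))"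
    if "x \<in> S" "t \<in> {0..1}" for x t v
    unfolding G_def \<alpha>_sum[OF \<gamma>S[OF that], of v] D_sum[OF \<gamma>S[OF that], of v]
    by (simp add: sum.distrib sum_distrib_left mult_ac)
  have derF: "((\<lambda>x. F x t) has_derivative G x t) (at x)" if "x \<in> S" "t \<in> {0..1}" for x t
  proof -
    have d\<gamma>: "((\<lambda>x. \<gamma> x t) has_derivative (\<lambda>v. t *\<^sub>R v)) (at x)"
      unfolding \<gamma>_def by (auto intro!: derivative_eq_intros)
    have "((\<lambda>x. \<alpha> (\<gamma> x t) b) has_derivative (\<lambda>v. D b (\<gamma> x t) (t *\<^sub>R v))) (at x)" for b
      using has_derivative_compose[OF d\<gamma> D[OF \<gamma>S[OF that], of b]] .
    then have "((\<lambda>x. \<Sum>b\<in>Basis. ((x - x0) \<bullet> b) * \<alpha> (\<gamma> x t) b) has_derivative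
        (\<lambda>v. \<Sum>b\<in>Basis. ((x - x0) \<bullet> b) * D b (\<gamma> x t) (t *\<^sub>R v) + (v \<bullet> b) * \<alpha> (\<gamma> x t) b)) (at x)"
      by (auto intro!: derivative_eq_intros)
    moreover have "(\<lambda>v. \<Sum>b\<in>Basis. ((x - x0) \<bullet> b) * D b (\<gamma> x t) (t *\<^sub>R v) + (v \<bullet> b) * \<alpha> (\<gamma> x t) b) = G x t"
      by (rule ext) (simp add: G_sum[OF that] linear_scale[OF linD[OF \<gamma>S[OF that]]] add.commute)
    ultimately have "((\<lambda>x. \<Sum>b\<in>Basis. ((x - x0) \<bullet> b) * \<alpha> (\<gamma> x t) b) has_derivative G x t) (at x)" by simp
    then show ?thesis
      by (rule has_derivative_transform_within_open[OF _ S(1) that(1)])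
        (simp add: F_def \<alpha>_sum[OF \<gamma>S[OF _ that(2)], symmetric])
  qed
  have linG: "linear (G x t)" if "x \<in> S" "t \<in> {0..1}" for x t
    using derF[OF that] by (rule has_derivative_linear)
  have cont\<gamma>: "continuous_on (S \<times> {0..1}) (\<lambda>(x, t). \<gamma> x t)"
    unfolding \<gamma>_def split_beta by (intro continuous_intros)
  have im\<gamma>: "(\<lambda>(x, t). \<gamma> x t) ` (S \<times> {0..1}) \<subseteq> S" using \<gamma>S by auto
  have cont\<alpha>: "continuous_on S (\<lambda>y. \<alpha> y v)" for v
    using D by (meson continuous_at_imp_continuous_on has_derivative_continuous)
  have contG: "continuous_on (S \<times> {0..1}) (\<lambda>(x, t). G x t v)" for v
  proof -
    have 1: "continuous_on (S \<times> {0..1}) (\<lambda>p. \<alpha> (\<gamma> (fst p) (snd p)) b)" for b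
      using continuous_on_compose2[OF cont\<alpha>[of b] cont\<gamma> im\<gamma>] by (simp add: split_beta)
    have 2: "continuous_on (S \<times> {0..1}) (\<lambda>p. D b (\<gamma> (fst p) (snd p)) v)" for b
      using continuous_on_compose2[OF cont[of b v] cont\<gamma> im\<gamma>] by (simp add: split_beta)
    have "continuous_on (S \<times> {0..1}) (\<lambda>p. \<Sum>b\<in>Basis. (v \<bullet> b) * \<alpha> (\<gamma> (fst p) (snd p)) b
        + ((fst p - x0) \<bullet> b) * (snd p * D b (\<gamma> (fst p) (snd p)) v))"
      by (intro continuous_intros 1 2)
    then show ?thesis
      by (rule continuous_on_eq) (use G_sum in auto)
  qed
  define B where "B = (\<lambda>x t. Blinfun (G x t))"
  have B: "blinfun_apply (B x t) = G x t" if "x \<in> S" "t \<in> {0..1}" for x t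
    unfolding B_def by (rule bounded_linear_Blinfun_apply) (use linG[OF that] in \<open>simp add: linear_conv_bounded_linear\<close>)
  have contB: "continuous_on (S \<times> cbox 0 1) (\<lambda>(x, t). B x t)"
  proof (rule continuous_on_blinfun_componentwise)
    fix i :: 'a
    show "continuous_on (S \<times> cbox 0 1) (\<lambda>p. blinfun_apply (case p of (x, t) \<Rightarrow> B x t) i)"
      unfolding cbox_interval by (rule continuous_on_eq[OF contG[of i]]) (auto simp: B)
  qed
  define f where "f = (\<lambda>x. integral (cbox 0 1) (F x))"
  have der: "(f has_derivative \<alpha> x) (at x)" if x: "x \<in> S" for x
  proof -
    have contF: "continuous_on (cbox 0 1) (F x)" if "x \<in> S" for x
    proof -
      have "continuous_on {0..1} (\<lambda>t. \<alpha> (\<gamma> x t) (x - x0))"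
        by (rule continuous_on_compose2[OF cont\<alpha>[of "x - x0"]])
          (use \<gamma>S that in \<open>auto simp: \<gamma>_def intro!: continuous_intros\<close>)
      then show ?thesis by (simp add: F_def)
    qed
    have "(f has_derivative integral (cbox 0 1) (B x)) (at x within S)"
      unfolding f_def
    proof (rule leibniz_rule[OF _ _ contB x S(2)])
      show "((\<lambda>x. F x t) has_derivative blinfun_apply (B x t)) (at x within S)"
        if "x \<in> S" "t \<in> cbox 0 1" for x t
        using derF[of x t] that by (auto simp: B intro: has_derivative_at_withinI)
      show "F x integrable_on cbox 0 1" if "x \<in> S" for x
        by (rule integrable_continuous[OF contF[OF that]])
    qed
    then have "(f has_derivative integral (cbox 0 1) (B x)) (at x)"
      using at_within_open[OF x S(1)] by simp
    moreover have "blinfun_apply (integral (cbox 0 1) (B x)) v = \<alpha> x v" for v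
    proof -
      have pair_cont: "continuous_on (cbox 0 1) (\<lambda>t::real. (x, t))" by (intro continuous_intros)
      have "continuous_on (cbox 0 1) (B x)"
        using continuous_on_compose2[OF contB pair_cont] x
        by (simp add: image_subset_iff)
      then have "blinfun_apply (integral (cbox 0 1) (B x)) v = integral (cbox 0 1) (\<lambda>t. blinfun_apply (B x t) v)"
        by (rule blinfun_apply_integral[OF integrable_continuous])
      also have "\<dots> = integral {0..1} (\<lambda>t. G x t v)"
        unfolding cbox_interval
        by (rule Henstock_Kurzweil_Integration.integral_cong) (simp add: B[OF x])
      also have "\<dots> = 1 * \<alpha> (\<gamma> x 1) v - 0 * \<alpha> (\<gamma> x 0) v"
      proof (rule integral_unique, rule fundamental_theorem_of_calculus)
        fix t :: real assume t: "t \<in> {0..1}"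
        have d\<gamma>: "((\<lambda>t. \<gamma> x t) has_derivative (\<lambda>h. h *\<^sub>R (x - x0))) (at t)"
          unfolding \<gamma>_def by (auto intro!: derivative_eq_intros)
        have "((\<lambda>t. \<alpha> (\<gamma> x t) v) has_derivative (\<lambda>h. D v (\<gamma> x t) (h *\<^sub>R (x - x0)))) (at t)"
          using has_derivative_compose[OF d\<gamma> D[OF \<gamma>S[OF x t], of v]] .
        then have "((\<lambda>t. \<alpha> (\<gamma> x t) v) has_derivative (\<lambda>h. h * D v (\<gamma> x t) (x - x0))) (at t)"
          by (simp add: linear_scale[OF linD[OF \<gamma>S[OF x t]]])
        then have "((\<lambda>t. t * \<alpha> (\<gamma> x t) v) has_derivative (\<lambda>h. h * G x t v)) (at t)"
          by (auto intro!: derivative_eq_intros simp: G_def algebra_simps)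
        then show "((\<lambda>t. t * \<alpha> (\<gamma> x t) v) has_vector_derivative G x t v) (at t within {0..1})"
          by (simp add: has_vector_derivative_def has_derivative_at_withinI)
      qed auto
      finally show ?thesis by (simp add: \<gamma>_def)
    qed
    ultimately show ?thesis by (metis ext)
  qed
  then show ?thesis using that by blast
qed

text \<open>Integrating the curl over \<open>y \<in> [0, R]\<close> shows that \<open>G x = (\<integral> g2 x y dy)\<close> has derivative at least
  \<open>c * R - 2 * M\<close>, which is at least 1 for a suitable \<open>R\<close>. But \<open>G\<close> is bounded by \<open>M * R\<close>.\<close>

lemma bounded_fields_no_positive_curl:
  fixes g1 g2 g1y g2x :: "real \<Rightarrow> real \<Rightarrow> real"
  assumes d1: "\<And>x y. (g1 x has_real_derivative g1y x y) (at y)"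
    and d2: "\<And>x y. ((\<lambda>x. g2 x y) has_real_derivative g2x x y) (at x)"
    and cont: "continuous_on UNIV (\<lambda>(x, y). g2x x y)"
    and cont2: "\<And>x. continuous_on UNIV (g2 x)"
    and bound: "\<And>x y. \<bar>g1 x y\<bar> \<le> M" "\<And>x y. \<bar>g2 x y\<bar> \<le> M"
    and curl: "\<And>x y. g2x x y - g1y x y \<ge> c"
    and "c > 0"
  shows False
proof -
  have M: "M \<ge> 0" using bound(1)[of 0 0] by linarith
  \<comment> \<open>Chosen so that \<open>c * R - 2 * M = 1\<close>.\<close>
  define R where "R = (2 * M + 1) / c"
  have R: "R > 0" "c * R = 2 * M + 1" using M \<open>c > 0\<close> by (auto simp: R_def)
  have int: "g2 x integrable_on {0..R}" for x
    by (rule integrable_continuous_real[OF continuous_on_subset[OF cont2]]) auto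
  define G where "G = (\<lambda>x. integral (cbox 0 R) (g2 x))"
  have G: "(G has_real_derivative integral (cbox 0 R) (g2x x)) (at x)" for x
    unfolding G_def
    by (rule leibniz_rule_field_derivative[where U = UNIV, OF _ _ continuous_on_subset[OF cont]])
      (auto intro!: d2 int)
  have pos: "integral (cbox 0 R) (g2x x) \<ge> 1" for x
  proof -
    have "((\<lambda>y. g1y x y) has_integral g1 x R - g1 x 0) {0..R}"
      by (rule fundamental_theorem_of_calculus)
        (use R d1 in \<open>auto simp: has_real_derivative_iff_has_vector_derivative intro: has_vector_derivative_at_within\<close>)
    from has_integral_add[OF has_integral_const_real[of c 0 R] this]
    have 1: "((\<lambda>y. c + g1y x y) has_integral c * R + (g1 x R - g1 x 0)) {0..R}"
      using R by (simp add: mult.commute)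
    have pair_cont: "continuous_on {0..R} (\<lambda>y. (x, y))" by (intro continuous_intros)
    have "continuous_on {0..R} (g2x x)"
      using continuous_on_compose2[OF cont pair_cont]
      by simp
    then have "g2x x integrable_on {0..R}" by (rule integrable_continuous_real)
    then have 2: "(g2x x has_integral integral {0..R} (g2x x)) {0..R}" by (rule integrable_integral)
    have "c * R + (g1 x R - g1 x 0) \<le> integral {0..R} (g2x x)"
      by (rule has_integral_le[OF 1 2]) (use curl in \<open>simp add: algebra_simps\<close>)
    then show ?thesis using bound(1)[of x R] bound(1)[of x 0] R(2) by simp
  qed
  have Gb: "\<bar>G x\<bar> \<le> M * R" for x
  proof -
    have "norm (integral (cbox 0 R) (g2 x)) \<le> M * measure lborel (cbox 0 R)"
      by (rule integrable_bound[OF M]) (use bound(2) in \<open>auto intro!: int\<close>)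
    then show ?thesis using R by (simp add: G_def)
  qed
  define T where "T = 2 * M * R + 1"
  have T: "T > 0" using M R by (simp add: T_def add_nonneg_pos)
  obtain z where "G T - G 0 = (T - 0) * integral (cbox 0 R) (g2x z)"
    using MVT2[OF T, of G "\<lambda>x. integral (cbox 0 R) (g2x x)"] G by blast
  then have "G T - G 0 \<ge> T" using mult_left_mono[OF pos[of z], of T] T by simp
  then show False using Gb[of T] Gb[of 0] by (simp add: T_def)
qed

section \<open>Arithmetic of Oeljeklaus-Toma data\<close>

locale oeljeklaus_toma =
  fixes \<sigma> :: "'s::finite \<Rightarrow> 'k::field_char_0 \<Rightarrow> real"
    and \<tau> :: "'k \<Rightarrow> complex"
    and U :: "'k set"
  assumes data: "oeljeklaus_toma_data \<sigma> \<tau> U"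
begin

text \<open>Since the embeddings are all of these, the degree of the field is \<open>CARD('s) + 2\<close>, and a nondegenerate family is
  indexed by \<open>'s + bool\<close>.\<close>

definition emb :: "'s + bool \<Rightarrow> 'k \<Rightarrow> complex" where
  "emb j = (case j of Inl i \<Rightarrow> (\<lambda>x. of_real (\<sigma> i x)) | Inr b \<Rightarrow> if b then \<tau> else (\<lambda>x. cnj (\<tau> x)))"

lemma emb_simps [simp]:
  "emb (Inl i) x = of_real (\<sigma> i x)" "emb (Inr True) x = \<tau> x" "emb (Inr False) x = cnj (\<tau> x)"
  by (simp_all add: emb_def)

lemma field_embedding_\<sigma>: "field_embedding (\<sigma> i)"
  using data by (auto simp: oeljeklaus_toma_data_def bij_betw_def)

lemma nonreal_embeddings:
  "{f :: 'k \<Rightarrow> complex. field_embedding f \<and> \<not> range f \<subseteq> \<real>} = {\<tau>, \<lambda>x. cnj (\<tau> x)}"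
  using data by (simp add: oeljeklaus_toma_data_def)

lemma range_emb: "range emb = {f. field_embedding f}"
proof (intro equalityI subsetI)
  fix f assume "f \<in> range emb"
  then obtain j where j: "f = emb j" by blast
  show "f \<in> {f. field_embedding f}"
  proof (cases j)
    case (Inl i)
    then show ?thesis using field_embedding_\<sigma>[of i] unfolding j by (simp add: field_embedding_def)
  next
    case (Inr b)
    then have "f \<in> {\<tau>, \<lambda>x. cnj (\<tau> x)}" by (simp add: j emb_def)
    then show ?thesis using nonreal_embeddings by blast
  qed
next
  fix f :: "'k \<Rightarrow> complex" assume "f \<in> {f. field_embedding f}"
  then have f: "field_embedding f" by simp
  show "f \<in> range emb"
  proof (cases "range f \<subseteq> \<real>")
    case True
    then have Re: "f x = of_real (Re (f x))" for x by (metis of_real_Re range_subsetD)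
    have "field_embedding (\<lambda>x. Re (f x))"
      using f unfolding field_embedding_def
      by (metis Re of_real_1 of_real_add of_real_eq_iff of_real_mult)
    then have "(\<lambda>x. Re (f x)) \<in> range \<sigma>"
      using data by (simp add: oeljeklaus_toma_data_def bij_betw_def)
    then obtain i where i: "\<sigma> i = (\<lambda>x. Re (f x))" by (metis imageE)
    then have "f = emb (Inl i)" using Re by (intro ext) simp
    then show ?thesis by blast
  next
    case False
    then have "f \<in> {\<tau>, \<lambda>x. cnj (\<tau> x)}" using f nonreal_embeddings by blast
    then have "f = emb (Inr True) \<or> f = emb (Inr False)" by (auto simp: emb_def)
    then show ?thesis by blast
  qed
qed

lemma inj_emb: "inj emb"
proof -
  have "\<tau> \<in> {f. field_embedding f \<and> \<not> range f \<subseteq> \<real>}" using nonreal_embeddings by blast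
  then obtain x where x: "\<tau> x \<notin> \<real>" by auto
  then have x': "cnj (\<tau> x) \<notin> \<real>" "\<tau> x \<noteq> cnj (\<tau> x)"
    by (metis Reals_cnj_iff complex_cnj_cnj)+
  have inj\<sigma>: "inj \<sigma>" using data by (auto simp: oeljeklaus_toma_data_def bij_betw_def)
  have 1: "emb (Inl i) \<noteq> emb (Inr b)" for i b
  proof
    assume eq: "emb (Inl i) = emb (Inr b)"
    have "emb (Inl i) x \<in> \<real>" by simp
    moreover have "emb (Inr b) x \<notin> \<real>" using x by (cases b) auto
    ultimately show False using eq by metis
  qed
  have 2: "emb (Inl i) = emb (Inl j) \<Longrightarrow> i = j" for i j
    using inj\<sigma> by (metis emb_simps(1) ext injD of_real_eq_iff)
  have 3: "emb (Inr b) = emb (Inr c) \<Longrightarrow> b = c" for b c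
    using x'(2) by (cases b; cases c) (auto dest: fun_cong[of _ _ x])
  show ?thesis
  proof (rule injI)
    fix i j assume "emb i = emb j"
    then show "i = j" by (cases i; cases j) (auto simp: 1 1[symmetric] dest: 2 3)
  qed
qed

sublocale number_field_embeddings emb
  using data range_emb inj_emb by unfold_locales (simp_all add: oeljeklaus_toma_data_def)

sublocale \<sigma>: field_hom "\<sigma> i" for i
  by (rule field_embedding_imp_field_hom[OF field_embedding_\<sigma>])

sublocale \<tau>: field_hom \<tau>
  by (rule field_embedding_imp_field_hom) (use nonreal_embeddings in blast)

lemma prod_emb: "(\<Prod>j\<in>UNIV. g j) = (\<Prod>i\<in>UNIV. g (Inl i)) * g (Inr True) * g (Inr False)"
  for g :: "'s + bool \<Rightarrow> 'c::comm_monoid_mult"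
proof -
  have "(\<Prod>j\<in>UNIV. g j) = (\<Prod>j\<in>UNIV <+> UNIV. g j)" by (simp add: UNIV_Plus_UNIV)
  also have "\<dots> = (\<Prod>i\<in>UNIV. g (Inl i)) * (\<Prod>b\<in>UNIV. g (Inr b))"
    by (subst prod.Plus) (simp_all add: o_def)
  finally show ?thesis by (simp add: UNIV_bool mult_ac)
qed

lemma integral_units_mult: "u \<in> integral_units \<Longrightarrow> v \<in> integral_units \<Longrightarrow> u * v \<in> integral_units"
  for u v :: 'k
  by (auto simp: integral_units_def ring_of_integers_def algebraic_int_mult)

lemma integral_units_one: "1 \<in> integral_units"
  by (simp add: integral_units_def ring_of_integers_def)

lemma integral_units_nonzero: "u \<in> integral_units \<Longrightarrow> u \<noteq> 0"
  by (simp add: integral_units_def)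

lemma group_positive_units: "group (positive_units \<sigma>)"
proof (rule groupI)
  fix u assume u: "u \<in> carrier (positive_units \<sigma>)"
  then have "inverse u \<in> carrier (positive_units \<sigma>)"
    by (auto simp: positive_units_def integral_units_def \<sigma>.hom_inverse)
  moreover have "inverse u \<otimes>\<^bsub>positive_units \<sigma>\<^esub> u = \<one>\<^bsub>positive_units \<sigma>\<^esub>"
    using u by (auto simp: positive_units_def integral_units_def)
  ultimately show "\<exists>v\<in>carrier (positive_units \<sigma>). v \<otimes>\<^bsub>positive_units \<sigma>\<^esub> u = \<one>\<^bsub>positive_units \<sigma>\<^esub>" by blast
qed (auto simp: positive_units_def integral_units_mult integral_units_one \<sigma>.hom_mult mult.assoc)

lemma subgroup_U: "subgroup U (positive_units \<sigma>)"
  using data by (simp add: oeljeklaus_toma_data_def)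

lemma U_units: "u \<in> U \<Longrightarrow> u \<in> integral_units" and U_pos: "u \<in> U \<Longrightarrow> \<sigma> i u > 0"
  using subgroup.subset[OF subgroup_U] by (auto simp: positive_units_def)

lemma U_algebraic_int: "u \<in> U \<Longrightarrow> algebraic_int u" and U_nonzero: "u \<in> U \<Longrightarrow> u \<noteq> 0"
  using U_units by (auto simp: integral_units_def ring_of_integers_def)

lemma U_one: "1 \<in> U"
  using subgroup.one_closed[OF subgroup_U] by (simp add: positive_units_def)

lemma U_mult: "u \<in> U \<Longrightarrow> v \<in> U \<Longrightarrow> u * v \<in> U"
  using subgroup.m_closed[OF subgroup_U] by (simp add: positive_units_def)

lemma U_inverse: "u \<in> U \<Longrightarrow> inverse u \<in> U"
proof -
  assume u: "u \<in> U"
  interpret group "positive_units \<sigma>" by (rule group_positive_units)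
  have c: "u \<in> carrier (positive_units \<sigma>)" using u subgroup.subset[OF subgroup_U] by blast
  have "inv\<^bsub>positive_units \<sigma>\<^esub> u = inverse u"
    by (rule inv_equality) (use c in \<open>auto simp: positive_units_def integral_units_def \<sigma>.hom_inverse\<close>)
  then show ?thesis using subgroup.m_inv_closed[OF subgroup_U u] by simp
qed

text \<open>The square of a unit whose absolute value at a real place is not 1 is positive at all real places.
  Two of its powers lie in the same coset of \<open>U\<close>, because the index is finite; their quotient is in \<open>U\<close> and is not 1
  at that place.\<close>

lemma U_nontrivial: obtains u where "u \<in> U" "u \<noteq> 1"
proof -
  obtain i :: 's where True by blast
  have n: "CARD('s + bool) \<ge> 2" by (simp add: card_UNIV_sum)
  obtain v where v: "v \<in> integral_units" "norm (emb (Inl i) v) \<noteq> 1"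
    by (rule exists_unit_not_norm_1[of "Inl i", OF _ n]) auto
  define w where "w = v * v"
  define s where "s = \<sigma> i w"
  have w: "w \<in> carrier (positive_units \<sigma>)"
    using v(1) integral_units_nonzero[OF v(1)]
    by (simp add: w_def positive_units_def integral_units_mult \<sigma>.hom_mult zero_less_mult_iff flip: linorder_neq_iff)
  have s: "s > 0" using w by (simp add: s_def positive_units_def)
  have s1: "s \<noteq> 1"
  proof
    assume "s = 1"
    then have "\<bar>\<sigma> i v\<bar> ^ 2 = 1" by (simp add: s_def w_def \<sigma>.hom_mult power2_eq_square)
    then have "\<bar>\<sigma> i v\<bar> = 1" using power2_eq_1_iff[of "\<bar>\<sigma> i v\<bar>"] by linarith
    then show False using v(2) by simp
  qed
  have wn: "w ^ n \<in> carrier (positive_units \<sigma>)" for n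
  proof (induction n)
    case 0
    then show ?case by (simp add: positive_units_def integral_units_def ring_of_integers_def)
  next
    case (Suc n)
    then show ?case using w by (auto simp: positive_units_def integral_units_mult \<sigma>.hom_mult)
  qed
  let ?c = "\<lambda>n. U #>\<^bsub>positive_units \<sigma>\<^esub> (w ^ n)"
  have "range ?c \<subseteq> rcosets\<^bsub>positive_units \<sigma>\<^esub> U" using wn by (auto simp: RCOSETS_def)
  moreover have "finite (rcosets\<^bsub>positive_units \<sigma>\<^esub> U)" using data by (simp add: oeljeklaus_toma_data_def)
  ultimately have "finite (range ?c)" by (rule finite_subset)
  then have "\<not> inj ?c" using range_inj_infinite by blast
  then obtain m n where mn: "m \<noteq> n" "?c m = ?c n" by (auto simp: inj_on_def)
  have "w ^ m \<in> ?c m" using U_one by (auto simp: r_coset_def positive_units_def)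
  then have "w ^ m \<in> ?c n" using mn(2) by simp
  then obtain h where h: "h \<in> U" "w ^ m = h * w ^ n" by (auto simp: r_coset_def positive_units_def)
  have "h \<noteq> 1"
  proof
    assume "h = 1"
    then have "s ^ m = s ^ n" using h(2) by (simp add: s_def flip: \<sigma>.hom_power)
    then have "real m * ln s = real n * ln s" using s by (metis ln_realpow)
    then show False using mn(1) s s1 by simp
  qed
  then show ?thesis using h(1) that by blast
qed

text \<open>The coordinates \<open>d\<close> of the vector of \<open>x\<close>, \<open>w\<close> and \<open>cnj w\<close> with respect to an integral basis are real: the
  complex conjugate of \<open>d\<close> represents the same vector. So they can be rounded to integers.\<close>

lemma cocompact:
  "\<exists>C>0. \<forall>(x :: 's \<Rightarrow> real) w. \<exists>a. algebraic_int a \<and> (\<forall>i. \<bar>x i - \<sigma> i a\<bar> \<le> C) \<and> norm (w - \<tau> a) \<le> C"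
proof -
  obtain b where b: "\<And>j. algebraic_int (b j)" "det (embedding_matrix b) \<noteq> 0"
    using exists_integral_basis by blast
  obtain C where C: "C > 0" "\<And>d :: 's + bool \<Rightarrow> real. \<exists>z :: 's + bool \<Rightarrow> int. \<forall>i.
     norm ((\<Sum>j\<in>UNIV. of_real (d j) * emb i (b j)) - emb i (\<Sum>j\<in>UNIV. of_int (z j) * b j)) \<le> C"
    using round_to_integral_combination[of b] by blast
  have "\<exists>a. algebraic_int a \<and> (\<forall>i. \<bar>x i - \<sigma> i a\<bar> \<le> C) \<and> norm (w - \<tau> a) \<le> C" for x :: "'s \<Rightarrow> real" and w
  proof -
    define y where "y = (\<lambda>j. case j of Inl i \<Rightarrow> of_real (x i) | Inr b \<Rightarrow> if b then w else cnj w)"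
    obtain d where d: "\<And>i. y i = (\<Sum>j\<in>UNIV. d j * emb i (b j))"
      using nondegenerate_coordinates[OF b(2), of y] by blast
    have "cnj (y (Inl i)) = y (Inl i)" "cnj (y (Inr True)) = y (Inr False)"
      "cnj (y (Inr False)) = y (Inr True)" for i by (simp_all add: y_def)
    then have conj: "y (Inl i) = (\<Sum>j\<in>UNIV. cnj (d j) * emb (Inl i) (b j))"
      "y (Inr True) = (\<Sum>j\<in>UNIV. cnj (d j) * emb (Inr True) (b j))"
      "y (Inr False) = (\<Sum>j\<in>UNIV. cnj (d j) * emb (Inr False) (b j))" for i
      using arg_cong[OF d[of "Inl i"], of cnj] arg_cong[OF d[of "Inr True"], of cnj]
        arg_cong[OF d[of "Inr False"], of cnj]
      by simp_all
    have d': "y i = (\<Sum>j\<in>UNIV. cnj (d j) * emb i (b j))" for i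
    proof (cases i)
      case (Inl k)
      then show ?thesis using conj(1)[of k] by simp
    next
      case (Inr c)
      then show ?thesis using conj(2,3) by (cases c) simp_all
    qed
    have "d j - cnj (d j) = 0" for j
      by (rule nondegenerate_unique[OF b(2)]) (use d d' in \<open>simp add: left_diff_distrib sum_subtractf\<close>)
    then have "of_real (Re (d j)) = d j" for j by (metis Reals_cnj_iff eq_iff_diff_eq_0 of_real_Re)
    then have y: "y i = (\<Sum>j\<in>UNIV. of_real (Re (d j)) * emb i (b j))" for i using d[of i] by simp
    obtain z :: "'s + bool \<Rightarrow> int" where z: "\<And>i. norm (y i - emb i (\<Sum>j\<in>UNIV. of_int (z j) * b j)) \<le> C"
      using C(2)[of "\<lambda>j. Re (d j)"] unfolding y by blast
    define a where "a = (\<Sum>j\<in>UNIV. of_int (z j) * b j)"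
    have "algebraic_int a" unfolding a_def using b by (intro algebraic_int_sum algebraic_int_mult) auto
    moreover have "\<bar>x i - \<sigma> i a\<bar> \<le> C" for i
      using z[of "Inl i"] unfolding a_def[symmetric] by (simp add: y_def flip: of_real_diff)
    moreover have "norm (w - \<tau> a) \<le> C"
      using z[of "Inr True"] unfolding a_def[symmetric] by (simp add: y_def)
    ultimately show ?thesis by blast
  qed
  then show ?thesis using C(1) by blast
qed

lemma unit_norm:
  assumes "u \<in> U" shows "(\<Prod>i\<in>UNIV. \<sigma> i u) * norm (\<tau> u) ^ 2 = 1"
proof -
  have "norm (field_norm u) * norm (field_norm (inverse u)) = 1"
    using U_nonzero[OF assms] by (simp flip: norm_mult field_norm_mult add: field_norm_1)
  moreover have "norm (field_norm u) \<ge> 1" "norm (field_norm (inverse u)) \<ge> 1"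
    using assms U_inverse U_nonzero U_algebraic_int by (auto intro!: field_norm_ge_1)
  ultimately have "norm (field_norm u) = 1"
    by (smt (verit) mult_le_cancel_left1)
  moreover have "norm (field_norm u) = (\<Prod>i\<in>UNIV. \<sigma> i u) * norm (\<tau> u) ^ 2"
    using U_pos[OF assms]
    by (simp add: field_norm_def prod_emb norm_mult power2_eq_square abs_prod less_imp_le flip: prod_norm)
  ultimately show ?thesis by simp
qed

text \<open>As the norm of \<open>u\<close> is 1, closeness to 1 at the real places bounds \<open>\<tau> u\<close>. In the norm of \<open>u - 1\<close> the real
  conjugates are then small enough to outweigh the others, so \<open>u - 1 = 0\<close>.\<close>

lemma unit_eq_1:
  assumes u: "u \<in> U" and near: "\<And>i. \<bar>\<sigma> i u - 1\<bar> \<le> 1 / (2 * (1 + 2 ^ CARD('s)) ^ 2)"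
  shows "u = 1"
proof -
  \<comment> \<open>Each \<open>\<sigma> i u\<close> is at least 1/2, so the norm equation gives \<open>norm (\<tau> u) ^ 2 \<le> K\<close>.\<close>
  define K :: real where "K = 2 ^ CARD('s)"
  define \<delta> where "\<delta> = 1 / (2 * (1 + K) ^ 2)"
  have K: "K \<ge> 1" by (simp add: K_def)
  have \<delta>: "0 < \<delta>" "\<delta> \<le> 1/2" "\<delta> * (1 + K) ^ 2 = 1/2"
  proof -
    show "0 < \<delta>" using K by (simp add: \<delta>_def)
    show "\<delta> * (1 + K) ^ 2 = 1/2" using K by (simp add: \<delta>_def)
    have "(1 + K) ^ 2 \<ge> 1" using K by (simp add: one_le_power)
    then have "\<delta> * 1 \<le> \<delta> * (1 + K) ^ 2" using \<open>0 < \<delta>\<close> by (intro mult_left_mono) auto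
    then show "\<delta> \<le> 1/2" using \<open>\<delta> * (1 + K) ^ 2 = 1/2\<close> by simp
  qed
  have near': "\<bar>\<sigma> i u - 1\<bar> \<le> \<delta>" for i using near by (simp add: \<delta>_def K_def)
  have half: "\<sigma> i u \<ge> 1/2" for i using near'[of i] \<delta> by linarith
  have "(\<Prod>i\<in>(UNIV::'s set). 1/2 :: real) \<le> (\<Prod>i\<in>UNIV. \<sigma> i u)"
    by (rule prod_mono) (use half in auto)
  then have P: "1 / K \<le> (\<Prod>i\<in>UNIV. \<sigma> i u)" by (simp add: K_def power_one_over)
  have "1 / K * norm (\<tau> u) ^ 2 \<le> (\<Prod>i\<in>UNIV. \<sigma> i u) * norm (\<tau> u) ^ 2"
    by (rule mult_right_mono[OF P]) simp
  then have "norm (\<tau> u) ^ 2 \<le> K" using unit_norm[OF u] K by (simp add: field_simps)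
  also have "K \<le> K ^ 2" using K by (simp add: power2_eq_square)
  finally have \<tau>K: "norm (\<tau> u) \<le> K" using K by (simp add: power2_le_iff_abs_le)
  have "u - 1 = 0"
  proof (rule integer_eq_0_if_norm_small)
    show "algebraic_int (u - 1)" using U_algebraic_int[OF u] by (simp add: algebraic_int_diff)
    have "norm (\<tau> (u - 1)) \<le> 1 + K"
      using norm_triangle_ineq4[of "\<tau> u" 1] \<tau>K by (simp add: \<tau>.hom_minus)
    then have 1: "norm (\<tau> (u - 1)) ^ 2 \<le> (1 + K) ^ 2" by (intro power_mono) auto
    have "(\<Prod>i\<in>UNIV. \<bar>\<sigma> i (u - 1)\<bar>) \<le> (\<Prod>i\<in>(UNIV::'s set). \<delta>)"
      by (rule prod_mono) (use near' in \<open>auto simp: \<sigma>.hom_minus\<close>)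
    also have "\<dots> = \<delta> ^ CARD('s)" by simp
    also have "\<dots> \<le> \<delta> ^ 1" using \<delta> by (intro power_decreasing) (auto simp: Suc_le_eq)
    finally have 2: "(\<Prod>i\<in>UNIV. \<bar>\<sigma> i (u - 1)\<bar>) \<le> \<delta>" by simp
    have "(\<Prod>i\<in>UNIV. norm (emb i (u - 1))) = (\<Prod>i\<in>UNIV. \<bar>\<sigma> i (u - 1)\<bar>) * norm (\<tau> (u - 1)) ^ 2"
      by (simp add: prod_emb power2_eq_square)
    also have "\<dots> \<le> \<delta> * (1 + K) ^ 2" using 1 2 \<delta> by (intro mult_mono) auto
    finally show "(\<Prod>i\<in>UNIV. norm (emb i (u - 1))) < 1" using \<delta>(3) by simp
  qed
  then show ?thesis by simp
qed

section \<open>The action of the group on the cover\<close>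

abbreviation "act \<equiv> ot_act \<sigma> \<tau>"
abbreviation "orb \<equiv> ot_orbit \<sigma> \<tau> U"
abbreviation "atlas \<equiv> ot_manifold \<sigma> \<tau> U"

definition act_linear :: "'k \<Rightarrow> (complex^'s) \<times> complex \<Rightarrow> (complex^'s) \<times> complex" where
  "act_linear u v = ((\<chi> i. of_real (\<sigma> i u) * fst v $ i), \<tau> u * snd v)"

definition translation :: "'k \<Rightarrow> (complex^'s) \<times> complex" where
  "translation a = ((\<chi> i. of_real (\<sigma> i a)), \<tau> a)"

lemma act_eq: "act u a p = act_linear u p + translation a"
  by (simp add: ot_act_def act_linear_def translation_def Finite_Cartesian_Product.vec_eq_iff)

lemma act_linear_1 [simp]: "act_linear 1 v = v"
  by (simp add: act_linear_def)

lemma translation_0 [simp]: "translation 0 = 0"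
  by (simp add: translation_def Finite_Cartesian_Product.vec_eq_iff zero_prod_def)

lemma act_1_0 [simp]: "act 1 0 p = p"
  by (simp add: act_eq)

lemma act_act: "act u a (act v b p) = act (u * v) (u * b + a) p"
  by (simp add: ot_act_def \<sigma>.hom_add \<sigma>.hom_mult \<tau>.hom_add \<tau>.hom_mult algebra_simps)

lemma bounded_linear_act_linear: "bounded_linear (act_linear u)"
  unfolding linear_conv_bounded_linear[symmetric]
  by (rule linearI) (simp_all add: act_linear_def Finite_Cartesian_Product.vec_eq_iff distrib_left)

lemma has_derivative_act: "(act u a has_derivative act_linear u) (at p)"
proof -
  have "((\<lambda>p. act_linear u p + translation a) has_derivative (\<lambda>v. act_linear u v + 0)) (at p)"
    by (intro has_derivative_add bounded_linear_imp_has_derivative bounded_linear_act_linear has_derivative_const)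
  then show ?thesis by (simp add: act_eq[abs_def])
qed

lemma continuous_on_act: "continuous_on S (act u a)"
  using has_derivative_act by (meson continuous_at_imp_continuous_on has_derivative_continuous)

lemma Im_act: "Im (fst (act u a p) $ i) = \<sigma> i u * Im (fst p $ i)"
  by (simp add: ot_act_def)

lemma mem_ot_cover_iff: "p \<in> ot_cover \<longleftrightarrow> (\<forall>i. Im (fst p $ i) > 0)"
  by (simp add: ot_cover_def split_beta)

lemma act_in_cover: "u \<in> U \<Longrightarrow> p \<in> ot_cover \<Longrightarrow> act u a p \<in> ot_cover"
  using U_pos by (simp add: mem_ot_cover_iff Im_act)

lemma open_ot_cover: "open (ot_cover :: ((complex^'s) \<times> complex) set)"
proof -
  have "ot_cover = (\<Inter>i. {p :: (complex^'s) \<times> complex. 0 < Im (fst p $ i)})"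
    by (auto simp: mem_ot_cover_iff)
  also have "open \<dots>"
    by (intro open_INT ballI open_Collect_less continuous_intros) auto
  finally show ?thesis .
qed

lemma convex_ot_cover: "convex (ot_cover :: ((complex^'s) \<times> complex) set)"
proof (rule convexI)
  fix p q :: "(complex^'s) \<times> complex" and a b :: real
  assume h: "p \<in> ot_cover" "q \<in> ot_cover" "0 \<le> a" "0 \<le> b" "a + b = 1"
  have "a * Im (fst p $ i) + b * Im (fst q $ i) > 0" for i
  proof (cases "a = 0")
    case True then show ?thesis using h by (simp add: mem_ot_cover_iff)
  next
    case False
    then have "a * Im (fst p $ i) > 0" using h by (simp add: mem_ot_cover_iff)
    moreover have "b * Im (fst q $ i) \<ge> 0" using h by (simp add: mem_ot_cover_iff less_imp_le)
    ultimately show ?thesis by linarith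
  qed
  then show "a *\<^sub>R p + b *\<^sub>R q \<in> ot_cover" by (simp add: mem_ot_cover_iff)
qed

lemma orb_act:
  assumes "u \<in> U" "algebraic_int a" shows "orb (act u a p) = orb p"
proof (intro equalityI subsetI)
  fix q assume "q \<in> orb (act u a p)"
  then obtain v b where "v \<in> U" "algebraic_int b" "q = act v b (act u a p)"
    by (auto simp: ot_orbit_def ring_of_integers_def)
  then show "q \<in> orb p" using assms U_mult U_algebraic_int
    by (auto simp: ot_orbit_def ring_of_integers_def act_act intro!: exI algebraic_int_add algebraic_int_mult)
next
  fix q assume "q \<in> orb p"
  then obtain v b where q: "v \<in> U" "algebraic_int b" "q = act v b p"
    by (auto simp: ot_orbit_def ring_of_integers_def)
  let ?v = "v * inverse u"
  have "q = act ?v (b - ?v * a) (act u a p)"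
    using q U_nonzero[OF assms(1)] by (simp add: act_act mult.assoc)
  moreover have "?v \<in> U" using q assms by (intro U_mult U_inverse)
  moreover have "algebraic_int (b - ?v * a)"
    using q(2) assms(2) U_algebraic_int[OF \<open>?v \<in> U\<close>] by (intro algebraic_int_diff algebraic_int_mult[of ?v])
  ultimately show "q \<in> orb (act u a p)" by (auto simp: ot_orbit_def ring_of_integers_def)
qed

lemma orb_eqD:
  assumes "orb q = orb p" obtains u a where "u \<in> U" "algebraic_int a" "q = act u a p"
proof -
  have "q \<in> orb q" unfolding ot_orbit_def ring_of_integers_def
    using U_one by (intro CollectI exI[of _ 1] exI[of _ 0]) auto
  then have "q \<in> orb p" using assms by simp
  then show ?thesis using that by (auto simp: ot_orbit_def ring_of_integers_def)
qed

section \<open>Charts of the quotient\<close>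

definition admissible :: "((complex^'s) \<times> complex) set \<Rightarrow> bool" where
  "admissible V \<longleftrightarrow> open V \<and> V \<subseteq> ot_cover \<and> inj_on orb V"

definition chart where "chart V = (orb ` V, inv_into V orb)"

lemma atlas_eq: "atlas = chart ` {V. admissible V}"
  by (auto simp: ot_manifold_def chart_def admissible_def)

text \<open>The action of the group is free and properly discontinuous. If \<open>q = u r + a\<close> with \<open>q\<close> and \<open>r\<close> close to \<open>p\<close>, then the
  imaginary parts show that \<open>u\<close> is close to 1 at the real places, so \<open>u = 1\<close>; then all conjugates of \<open>a\<close> are
  small, so \<open>a = 0\<close>.\<close>

lemma exists_admissible:
  assumes p: "p \<in> ot_cover" obtains V where "admissible V" "p \<in> V"
proof -
  define y where "y = Min (range (\<lambda>i. Im (fst p $ i)))"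
  have y: "y > 0" using p by (simp add: y_def mem_ot_cover_iff)
  have y_le: "y \<le> Im (fst p $ i)" for i by (simp add: y_def)
  define \<delta> :: real where "\<delta> = 1 / (2 * (1 + 2 ^ CARD('s)) ^ 2)"
  have "(1 + 2 ^ CARD('s)) ^ 2 \<ge> (1::real)" by (rule one_le_power) simp
  then have "1 / \<delta> \<ge> 1" unfolding \<delta>_def divide_divide_eq_right div_by_1 mult_1 by linarith
  then have \<delta>: "\<delta> > 0" "\<delta> \<le> 1" by (auto simp: le_divide_eq_1)
  \<comment> \<open>The second bound makes \<open>\<sigma> i u\<close> differ from 1 by at most \<open>\<delta>\<close>, the first makes the conjugates of \<open>a\<close>
    smaller than 1.\<close>
  define \<epsilon> where "\<epsilon> = min (1/2) (y * \<delta> / 4)"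
  have \<epsilon>: "\<epsilon> > 0" "\<epsilon> \<le> 1/2" "\<epsilon> \<le> y * \<delta> / 4" using y \<delta> by (auto simp: \<epsilon>_def)
  have "y * \<delta> \<le> y * 1" using y \<delta> by (intro mult_left_mono) auto
  then have \<epsilon>y: "\<epsilon> \<le> y / 4" using \<epsilon>(3) by linarith
  define V where "V = ball p \<epsilon> \<inter> ot_cover"
  have "inj_on orb V"
  proof (rule inj_onI)
    fix q r assume q: "q \<in> V" and r: "r \<in> V" and eq: "orb q = orb r"
    obtain u a where ua: "u \<in> U" "algebraic_int a" "q = act u a r" using orb_eqD[OF eq] by blast
    have dist_comp: "norm (fst s $ i - fst p $ i) < \<epsilon>" if "s \<in> V" for s i
    proof -
      have "dist (fst s $ i) (fst p $ i) \<le> dist (fst s) (fst p)" by (rule dist_vec_nth_le)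
      also have "\<dots> \<le> dist s p" by (rule dist_fst_le)
      also have "\<dots> < \<epsilon>" using that by (simp add: V_def dist_commute)
      finally show ?thesis by (simp add: dist_norm)
    qed
    have dist_snd: "norm (snd s - snd p) < \<epsilon>" if "s \<in> V" for s
    proof -
      have "dist (snd s) (snd p) \<le> dist s p" by (rule dist_snd_le)
      also have "\<dots> < \<epsilon>" using that by (simp add: V_def dist_commute)
      finally show ?thesis by (simp add: dist_norm)
    qed
    have "u = 1"
    proof (rule unit_eq_1[OF ua(1)])
      fix i
      have Im: "\<bar>Im (fst s $ i) - Im (fst p $ i)\<bar> < \<epsilon>" if "s \<in> V" for s
        using abs_Im_le_cmod[of "fst s $ i - fst p $ i"] dist_comp[OF that, of i] by simp
      have r0: "Im (fst r $ i) \<ge> y / 2" using Im[OF r] y_le[of i] \<epsilon>y y by linarith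
      have "\<bar>\<sigma> i u - 1\<bar> * (y / 2) \<le> \<bar>\<sigma> i u - 1\<bar> * Im (fst r $ i)"
        by (rule mult_left_mono[OF r0]) simp
      also have "\<dots> = \<bar>(\<sigma> i u - 1) * Im (fst r $ i)\<bar>" using r0 y by (simp add: abs_mult)
      also have "(\<sigma> i u - 1) * Im (fst r $ i) = Im (fst q $ i) - Im (fst r $ i)"
        by (simp add: ua(3) Im_act left_diff_distrib)
      also have "\<bar>\<dots>\<bar> \<le> 2 * \<epsilon>" using Im[OF q] Im[OF r] by linarith
      also have "\<dots> \<le> \<delta> * (y / 2)" using \<epsilon>(3) by (simp add: mult.commute)
      finally have "\<bar>\<sigma> i u - 1\<bar> \<le> \<delta>" using y by simp
      then show "\<bar>\<sigma> i u - 1\<bar> \<le> 1 / (2 * (1 + 2 ^ CARD('s)) ^ 2)" by (simp add: \<delta>_def)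
    qed
    have "a = 0"
    proof (rule integer_eq_0_if_conjugates_small[OF ua(2)])
      fix j
      have \<sigma>a: "\<bar>\<sigma> i a\<bar> < 1" for i
      proof -
        have "of_real (\<sigma> i a) = (fst q $ i - fst p $ i) - (fst r $ i - fst p $ i)"
          using ua(3) \<open>u = 1\<close> by (simp add: ot_act_def)
        then have "norm (of_real (\<sigma> i a) :: complex) \<le> norm (fst q $ i - fst p $ i) + norm (fst r $ i - fst p $ i)"
          by (simp only: norm_triangle_ineq4)
        then show ?thesis using dist_comp[OF q, of i] dist_comp[OF r, of i] \<epsilon>(2) by simp
      qed
      have \<tau>a: "norm (\<tau> a) < 1"
      proof -
        have "\<tau> a = (snd q - snd p) - (snd r - snd p)"
          using ua(3) \<open>u = 1\<close> by (simp add: ot_act_def)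
        then have "norm (\<tau> a) \<le> norm (snd q - snd p) + norm (snd r - snd p)"
          by (simp only: norm_triangle_ineq4)
        then show ?thesis using dist_snd[OF q] dist_snd[OF r] \<epsilon>(2) by simp
      qed
      show "norm (emb j a) < 1"
      proof (cases j)
        case (Inl i) then show ?thesis using \<sigma>a by simp
      next
        case (Inr b) then show ?thesis using \<tau>a by (cases b) auto
      qed
    qed
    then show "q = r" using ua(3) \<open>u = 1\<close> by simp
  qed
  then have "admissible V" by (simp add: admissible_def V_def open_ot_cover open_Int)
  moreover have "p \<in> V" using p \<epsilon>(1) by (simp add: V_def)
  ultimately show ?thesis using that by blast
qed

lemma chart_point:
  assumes "admissible V" "p \<in> V"
  shows "snd (chart V) (orb p) = p" "orb p \<in> fst (chart V)" "p \<in> chart_image (chart V)" "chart V \<in> atlas"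
proof -
  show 1: "snd (chart V) (orb p) = p" using assms by (simp add: chart_def admissible_def inv_into_f_f)
  show 2: "orb p \<in> fst (chart V)" using assms by (simp add: chart_def)
  show "p \<in> chart_image (chart V)" unfolding chart_image_def using 1 2 by (metis imageI)
  show "chart V \<in> atlas" using assms by (auto simp: atlas_eq)
qed

lemma chart_image_chart: "admissible V \<Longrightarrow> chart_image (chart V) = V"
  by (simp add: chart_image_def chart_def admissible_def inv_into_image_cancel image_image cong: image_cong_simp)

text \<open>Near \<open>p\<close> the change of coordinates is the group element itself. The case \<open>u = 1\<close>, \<open>a = 0\<close> compares two charts
  around the same point of the cover.\<close>

lemma transition_deriv_act:
  assumes V: "admissible V" "p \<in> V" and V': "admissible V'" "act u a p \<in> V'"
    and ua: "u \<in> U" "algebraic_int a"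
  shows "transition_deriv (chart V) (chart V') (orb p) = act_linear u"
proof -
  let ?W = "V \<inter> act u a -` V'"
  have W: "open ?W" "p \<in> ?W"
    using V V' continuous_on_act[of UNIV u a]
    by (auto simp: admissible_def intro!: open_Int open_vimage)
  have "transition (chart V) (chart V') x = act u a x" if x: "x \<in> ?W" for x
  proof -
    have "inv_into (fst (chart V)) (snd (chart V)) x = orb x"
    proof (rule inv_into_f_eq)
      show "inj_on (snd (chart V)) (fst (chart V))" by (simp add: chart_def inj_on_inv_into)
    qed (use x V chart_point in auto)
    then have "transition (chart V) (chart V') x = snd (chart V') (orb x)" by (simp add: transition_def)
    also have "\<dots> = snd (chart V') (orb (act u a x))" by (simp add: orb_act ua)
    also have "\<dots> = act u a x" using chart_point(1)[OF V'(1)] x by auto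
    finally show ?thesis .
  qed
  then have "(transition (chart V) (chart V') has_derivative act_linear u) (at p)"
    using has_derivative_transform_within_open[OF has_derivative_act W] by metis
  then show ?thesis
    unfolding transition_deriv_def chart_point(1)[OF V] by (rule frechet_derivative_at[symmetric])
qed

section \<open>Lifting one-forms to the cover\<close>

definition nbhd where "nbhd p = (SOME V. admissible V \<and> p \<in> V)"

lemma nbhd: "p \<in> ot_cover \<Longrightarrow> admissible (nbhd p)" "p \<in> ot_cover \<Longrightarrow> p \<in> nbhd p"
  unfolding nbhd_def by (metis (mono_tags, lifting) exists_admissible someI_ex)+

text \<open>The pullback of a one-form to the cover. By \<open>lift_eq\<close> below, the choice of the chart does not matter.\<close>

definition lift where "lift \<alpha> p = \<alpha> (chart (nbhd p)) p"

context
  fixes \<alpha> assumes \<alpha>: "one_form atlas \<alpha>"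
begin

lemma one_form_act:
  assumes V: "admissible V" "p \<in> V" and V': "admissible V'" "act u a p \<in> V'"
    and ua: "u \<in> U" "algebraic_int a"
  shows "\<alpha> (chart V) p v = \<alpha> (chart V') (act u a p) (act_linear u v)"
proof -
  have "orb p \<in> fst (chart V) \<inter> fst (chart V')"
    using chart_point(2)[OF V] chart_point(2)[OF V'] by (simp add: orb_act ua)
  then have "\<alpha> (chart V) (snd (chart V) (orb p)) v
      = \<alpha> (chart V') (snd (chart V') (orb p)) (transition_deriv (chart V) (chart V') (orb p) v)"
    using \<alpha> chart_point(4)[OF V] chart_point(4)[OF V'] unfolding one_form_def by blast
  moreover have "snd (chart V') (orb p) = act u a p"
    using chart_point(1)[OF V'] by (simp add: orb_act ua)
  ultimately show ?thesis by (simp add: chart_point(1)[OF V] transition_deriv_act[OF assms])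
qed

lemma lift_eq: "admissible V \<Longrightarrow> p \<in> V \<Longrightarrow> lift \<alpha> p v = \<alpha> (chart V) p v"
  using one_form_act[of "nbhd p" p V 1 0 v] nbhd[of p] U_one
  by (auto simp: lift_def admissible_def)

lemma lift_act:
  assumes "p \<in> ot_cover" "u \<in> U" "algebraic_int a"
  shows "lift \<alpha> (act u a p) (act_linear u v) = lift \<alpha> p v"
  unfolding lift_def using assms one_form_act[OF nbhd nbhd] act_in_cover by metis

lemma linear_lift: "p \<in> ot_cover \<Longrightarrow> linear (lift \<alpha> p)"
  using \<alpha> chart_point(3,4)[OF nbhd[of p]] by (simp add: one_form_def lift_def)

lemma chart_Ck:
  assumes V: "admissible V" shows "Ck_on (Suc 0) V (\<lambda>q. \<alpha> (chart V) q v)"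
proof -
  have "chart V \<in> atlas" using V by (simp add: atlas_eq)
  then have "smooth_on (chart_image (chart V)) (\<lambda>q. \<alpha> (chart V) q v)"
    using \<alpha> unfolding one_form_def by blast
  then show ?thesis unfolding chart_image_chart[OF V] smooth_on_def by blast
qed

lemma lift_has_derivative:
  assumes V: "admissible V" "p \<in> V"
  shows "((\<lambda>q. lift \<alpha> q v) has_derivative frechet_derivative (\<lambda>q. \<alpha> (chart V) q v) (at p)) (at p)"
proof -
  have "((\<lambda>q. \<alpha> (chart V) q v) has_derivative frechet_derivative (\<lambda>q. \<alpha> (chart V) q v) (at p)) (at p)"
    using chart_Ck[OF V(1)] V(2) by (simp add: frechet_derivative_works)
  then show ?thesis
    by (rule has_derivative_transform_within_open[of _ _ _ _ V])
      (use V lift_eq in \<open>auto simp: admissible_def\<close>)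
qed

definition dlift where "dlift v p = frechet_derivative (\<lambda>q. lift \<alpha> q v) (at p)"

lemma dlift_eq:
  assumes "admissible V" "p \<in> V"
  shows "dlift v p = frechet_derivative (\<lambda>q. \<alpha> (chart V) q v) (at p)"
  unfolding dlift_def using lift_has_derivative[OF assms] by (rule frechet_derivative_at[symmetric])

lemma dlift:
  assumes "p \<in> ot_cover"
  shows "((\<lambda>q. lift \<alpha> q v) has_derivative dlift v p) (at p)"
  using lift_has_derivative[OF nbhd[OF assms], of v] dlift_eq[OF nbhd[OF assms], of v] by simp

lemma continuous_on_dlift: "continuous_on ot_cover (\<lambda>p. dlift v p u)"
proof (rule continuous_at_imp_continuous_on, rule ballI)
  fix p :: "(complex^'s) \<times> complex" assume "p \<in> ot_cover"
  note V = nbhd[OF this]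
  have "continuous_on (nbhd p) (\<lambda>q. frechet_derivative (\<lambda>q. \<alpha> (chart (nbhd p)) q v) (at q) u)"
    using chart_Ck[OF V(1), of v] unfolding Ck_on.simps by blast
  then have "continuous_on (nbhd p) (\<lambda>q. dlift v q u)"
    by (rule continuous_on_eq) (simp add: dlift_eq[OF V(1)])
  then show "isCont (\<lambda>p. dlift v p u) p"
    using V by (simp add: continuous_on_eq_continuous_at admissible_def)
qed

lemma continuous_on_lift: "continuous_on ot_cover (\<lambda>p. lift \<alpha> p v)"
  using dlift by (meson continuous_at_imp_continuous_on has_derivative_continuous)

lemma lift_translation:
  assumes "p \<in> ot_cover" "algebraic_int a" shows "lift \<alpha> (act 1 a p) v = lift \<alpha> p v"
  using lift_act[OF assms(1) U_one assms(2), of v] by simp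

lemma dlift_translation:
  assumes p: "p \<in> ot_cover" and a: "algebraic_int a" shows "dlift v (act 1 a p) = dlift v p"
proof -
  have "((\<lambda>q. lift \<alpha> (act 1 a q) v) has_derivative (\<lambda>w. dlift v (act 1 a p) (act_linear 1 w))) (at p)"
    by (rule has_derivative_compose[OF has_derivative_act dlift[OF act_in_cover[OF U_one p]]])
  then have "((\<lambda>q. lift \<alpha> (act 1 a q) v) has_derivative dlift v (act 1 a p)) (at p)" by simp
  then have "((\<lambda>q. lift \<alpha> q v) has_derivative dlift v (act 1 a p)) (at p)"
    by (rule has_derivative_transform_within_open[OF _ open_ot_cover p]) (simp add: lift_translation a)
  then show ?thesis using dlift[OF p] has_derivative_unique by blast
qed

end

section \<open>Invariance of the primitive, and the contradiction on a complex line\<close>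

lemma closed_form_primitive:
  assumes "closed_one_form atlas \<theta>"
  obtains f where "\<And>p. p \<in> ot_cover \<Longrightarrow> (f has_derivative lift \<theta> p) (at p)"
proof -
  have \<theta>: "one_form atlas \<theta>" using assms by (simp add: closed_one_form_def)
  have "dlift \<theta> v p u = dlift \<theta> u p v" if "p \<in> ot_cover" for p u v
  proof -
    note V = nbhd[OF that]
    have "d1 \<theta> (chart (nbhd p)) p u v = 0"
      using assms chart_point(3,4)[OF V] unfolding closed_one_form_def eq2_def by blast
    then show ?thesis by (simp add: d1_def dlift_eq[OF \<theta> V])
  qed
  then show ?thesis
    using closed_one_form_has_primitive[OF open_ot_cover convex_ot_cover linear_lift[OF \<theta>] dlift[OF \<theta>]
        continuous_on_dlift[OF \<theta>]] that by blast
qed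

text \<open>The numbers \<open>c u a\<close> are the periods of \<open>\<theta>\<close> along the elements of the group. They define a homomorphism to the reals, and the
  translations by \<open>(u - 1) b\<close> are commutators.\<close>

lemma primitive_translation_invariant:
  assumes \<theta>: "one_form atlas \<theta>"
    and f: "\<And>p. p \<in> ot_cover \<Longrightarrow> (f has_derivative lift \<theta> p) (at p)"
    and p: "p \<in> ot_cover" and a: "algebraic_int a"
  shows "f (act 1 a p) = f p"
proof -
  have "\<exists>c. \<forall>p\<in>ot_cover. f (act u a p) - f p = c" if u: "u \<in> U" and a: "algebraic_int a" for u a
  proof (rule has_derivative_zero_constant[OF convex_ot_cover])
    fix p :: "(complex^'s) \<times> complex" assume p: "p \<in> ot_cover"
    have "((\<lambda>p. f (act u a p)) has_derivative (\<lambda>v. lift \<theta> (act u a p) (act_linear u v))) (at p)"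
      by (rule has_derivative_compose[OF has_derivative_act f[OF act_in_cover[OF u p]]])
    then have "((\<lambda>p. f (act u a p)) has_derivative lift \<theta> p) (at p)"
      by (simp add: lift_act[OF \<theta> p u a])
    from has_derivative_diff[OF this f[OF p]]
    show "((\<lambda>p. f (act u a p) - f p) has_derivative (\<lambda>h. 0)) (at p within ot_cover)"
      by (simp add: has_derivative_at_withinI)
  qed
  then obtain c where c: "\<And>u a p. u \<in> U \<Longrightarrow> algebraic_int a \<Longrightarrow> p \<in> ot_cover \<Longrightarrow> f (act u a p) = f p + c u a"
    by (metis add.commute diff_add_cancel)
  have c_add: "c 1 (a + b) = c 1 a + c 1 b" if "algebraic_int a" "algebraic_int b" for a b
  proof -
    have "act 1 (a + b) p = act 1 a (act 1 b p)" by (simp add: act_act add.commute)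
    then show ?thesis
      using c[OF U_one algebraic_int_add[OF that] p] c[OF U_one that(1) act_in_cover[OF U_one p]]
        c[OF U_one that(2) p] by simp
  qed
  have c_unit: "c 1 (u * a) = c 1 a" if u: "u \<in> U" and a: "algebraic_int a" for u a
  proof -
    \<comment> \<open>At this point \<open>f\<close> exceeds \<open>f p\<close> by \<open>c 1 (u * a) + c u 0\<close> and by \<open>c u 0 + c 1 a\<close>.\<close>
    have "act 1 (u * a) (act u 0 p) = act u 0 (act 1 a p)" by (simp add: act_act)
    moreover have "algebraic_int (u * a)" using u a by (simp add: algebraic_int_mult U_algebraic_int)
    moreover have z: "algebraic_int (0::'k)" by simp
    ultimately show ?thesis
      using c[OF U_one _ act_in_cover[OF u p], of "u * a" 0] c[OF u z p] c[OF U_one a p]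
        c[OF u z act_in_cover[OF U_one p], of a] by simp
  qed
  have c_nat: "c 1 (of_nat n * a) = of_nat n * c 1 a" if a: "algebraic_int a" for n a
  proof (induction n)
    case 0
    show ?case using c_add[of 0 0] by simp
  next
    case (Suc n)
    have "algebraic_int (of_nat n * a)" using a algebraic_int_mult[of "of_int (int n)" a] by simp
    then show ?case using Suc c_add[OF a, of "of_nat n * a"] by (simp add: distrib_right)
  qed
  obtain u where u: "u \<in> U" "u \<noteq> 1" using U_nontrivial by blast
  obtain N :: int where N: "N \<noteq> 0" "algebraic_int (of_int N * (1 / (u - 1)))"
    using exists_algebraic_int_multiple by blast
  define n where "n = nat \<bar>N\<bar>"
  have n: "n > 0" "of_nat n = (of_int \<bar>N\<bar> :: 'k)" using N(1) by (simp_all add: n_def)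
  have "algebraic_int (of_nat n * (1 / (u - 1)))"
    using N(2) algebraic_int_minus[OF N(2)] unfolding n(2) by (cases "N \<ge> 0") auto
  then have b: "algebraic_int (of_nat n * (1 / (u - 1)) * a)" (is "algebraic_int ?b")
    using a by (rule algebraic_int_mult)
  \<comment> \<open>So \<open>n a\<close> is \<open>(u - 1) b\<close> for the integer \<open>b\<close> just found.\<close>
  have "of_nat n * a + ?b = u * ?b" using u(2) by (simp add: field_simps)
  moreover have na: "algebraic_int (of_nat n * a)" using a algebraic_int_mult[of "of_int (int n)" a] by simp
  ultimately have "c 1 (of_nat n * a) = 0" using c_add[OF na b] c_unit[OF u(1) b] by simp
  then have "c 1 a = 0" using c_nat[OF a, of n] n(1) by simp
  then show ?thesis using c[OF U_one a p] by simp
qed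

text \<open>Here \<open>e1\<close> and \<open>e2 = J e1\<close> span the last complex coordinate direction, \<open>G v\<close> is the coefficient of
  \<open>exp (- f) \<eta>\<close> along \<open>v\<close> with derivative \<open>DG v\<close>, and \<open>h\<close> is the curl, equal to \<open>exp (- f) \<omega> e1 e2\<close>.\<close>

lemma no_exact_lck_form:
  assumes closed: "closed_one_form atlas \<theta>"
    and lck: "lck_form_with_lee_form atlas ot_J \<theta> \<omega>"
    and exact: "d_twisted_exact atlas \<theta> \<omega>"
  shows False
proof -
  have \<theta>: "one_form atlas \<theta>" using closed by (simp add: closed_one_form_def)
  obtain \<eta> where \<eta>: "one_form atlas \<eta>" and \<omega>\<eta>: "eq2 atlas \<omega> (d_twisted \<theta> \<eta>)"
    using exact by (auto simp: d_twisted_exact_def)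
  obtain g where g: "hermitian_metric atlas ot_J g" "eq2 atlas \<omega> (fundamental_form ot_J g)"
    using lck by (auto simp: lck_form_with_lee_form_def)
  obtain f where f: "\<And>p. p \<in> ot_cover \<Longrightarrow> (f has_derivative lift \<theta> p) (at p)"
    using closed_form_primitive[OF closed] by blast
  have f_per: "f (act 1 a p) = f p" if "p \<in> ot_cover" "algebraic_int a" for p a
    using primitive_translation_invariant[OF \<theta> f that] by blast
  define e1 :: "(complex^'s) \<times> complex" where "e1 = (0, 1)"
  define e2 :: "(complex^'s) \<times> complex" where "e2 = (0, \<i>)"
  define G where "G = (\<lambda>v p. exp (- f p) * lift \<eta> p v)"
  define DG where "DG = (\<lambda>v p u. exp (- f p) * (dlift \<eta> v p u - lift \<theta> p u * lift \<eta> p v))"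
  define h where "h = (\<lambda>p. DG e2 p e1 - DG e1 p e2)"
  have contf: "continuous_on ot_cover f"
    using f by (meson continuous_at_imp_continuous_on has_derivative_continuous)
  have contG: "continuous_on ot_cover (G v)" for v
    unfolding G_def by (intro continuous_intros contf continuous_on_lift[OF \<eta>])
  have contDG: "continuous_on ot_cover (\<lambda>p. DG v p u)" for v u
    unfolding DG_def
    by (intro continuous_intros contf continuous_on_lift[OF \<eta>] continuous_on_lift[OF \<theta>] continuous_on_dlift[OF \<eta>])
  have G_deriv: "(G v has_derivative DG v p) (at p)" if p: "p \<in> ot_cover" for v p
  proof -
    have "(G v has_derivative (\<lambda>u. exp (- f p) * dlift \<eta> v p u + (- lift \<theta> p u * exp (- f p)) * lift \<eta> p v)) (at p)"
      unfolding G_def by (intro has_derivative_mult dlift[OF \<eta> p] has_derivative_exp has_derivative_minus f[OF p])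
    then show ?thesis by (simp add: DG_def algebra_simps)
  qed
  \<comment> \<open>Positivity of the metric; the derivative of the factor \<open>exp (- f)\<close> supplies the term \<open>- \<theta> \<and> \<eta>\<close>.\<close>
  have h_pos: "h p > 0" if p: "p \<in> ot_cover" for p
  proof -
    note V = nbhd[OF p]
    note c = chart_point(3,4)[OF V]
    let ?c = "chart (nbhd p)"
    have "\<omega> ?c p e1 e2 = g ?c p (ot_J e1) e2" using g(2) c unfolding eq2_def fundamental_form_def by blast
    also have "ot_J e1 = e2" by (simp add: e1_def e2_def ot_J_def Finite_Cartesian_Product.vec_eq_iff)
    also have "g ?c p e2 e2 > 0"
    proof -
      have "e2 \<noteq> 0" by (simp add: e2_def zero_prod_def)
      then show ?thesis using g(1) c unfolding hermitian_metric_def by blast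
    qed
    finally have "\<omega> ?c p e1 e2 > 0" .
    moreover have "\<omega> ?c p e1 e2 = d_twisted \<theta> \<eta> ?c p e1 e2" using \<omega>\<eta> c unfolding eq2_def by blast
    moreover have "h p = exp (- f p) * d_twisted \<theta> \<eta> ?c p e1 e2"
      by (simp add: h_def DG_def d_twisted_def d1_def wedge11_def dlift_eq[OF \<eta> V]
          lift_eq[OF \<theta> V] lift_eq[OF \<eta> V] algebra_simps)
    ultimately show ?thesis by simp
  qed
  obtain C where C: "C > 0" "\<And>(x :: 's \<Rightarrow> real) w. \<exists>a. algebraic_int a \<and> (\<forall>i. \<bar>x i - \<sigma> i a\<bar> \<le> C) \<and> norm (w - \<tau> a) \<le> C"
    using cocompact by blast
  define z0 :: "complex^'s" where "z0 = (\<chi> i. \<i>)"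
  \<comment> \<open>A compact set of points of the cover that meets the orbit under translations of every point of the line
    through \<open>z0\<close>; its radius bounds the vectors with entries at most \<open>C\<close>.\<close>
  define K where "K = cball (z0, 0) (real CARD('s) * C + C) \<inter> (\<Inter>i. {p :: (complex^'s) \<times> complex. Im (fst p $ i) = 1})"
  have "closed {p :: (complex^'s) \<times> complex. Im (fst p $ i) = 1}" for i
    by (intro closed_Collect_eq continuous_intros)
  then have K: "compact K" unfolding K_def by (intro compact_Int_closed compact_cball closed_INT) auto
  have Kcover: "K \<subseteq> ot_cover" by (auto simp: K_def mem_ot_cover_iff)
  have K0: "(z0, 0) \<in> K" using C(1) by (simp add: K_def z0_def)
  have slice: "\<exists>a. algebraic_int a \<and> act 1 a (z0, w) \<in> K" for w
  proof -
    obtain a where a: "algebraic_int a" "\<And>i. \<bar>0 - \<sigma> i a\<bar> \<le> C" "norm (w - \<tau> a) \<le> C"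
      using C(2)[of "\<lambda>_. 0" w] by blast
    have "act 1 (- a) (z0, w) \<in> K"
    proof -
      have eq: "act 1 (- a) (z0, w) - (z0, 0) = (- (\<chi> i. complex_of_real (\<sigma> i a)), w - \<tau> a)"
        by (simp add: act_eq translation_def \<sigma>.hom_uminus \<tau>.hom_uminus Finite_Cartesian_Product.vec_eq_iff)
      have "norm (\<chi> i. complex_of_real (\<sigma> i a)) \<le> (\<Sum>i\<in>UNIV. \<bar>\<sigma> i a\<bar>)"
        unfolding norm_vec_def by (rule order.trans[OF L2_set_le_sum]) auto
      also have "\<dots> \<le> (\<Sum>i\<in>(UNIV::'s set). C)" using a(2) by (intro sum_mono) simp
      finally have 1: "norm (\<chi> i. complex_of_real (\<sigma> i a)) \<le> real CARD('s) * C" by simp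
      have "norm (act 1 (- a) (z0, w) - (z0, 0)) \<le> norm (- (\<chi> i. complex_of_real (\<sigma> i a))) + norm (w - \<tau> a)"
        unfolding eq by (rule norm_Pair_le)
      also have "\<dots> \<le> real CARD('s) * C + C" using 1 a(3) by simp
      finally show ?thesis by (simp add: K_def Im_act z0_def dist_norm norm_minus_commute)
    qed
    then show ?thesis using a(1) by (intro exI[of _ "- a"]) simp
  qed
  have cover0: "(z0, w) \<in> ot_cover" for w by (simp add: mem_ot_cover_iff z0_def)
  have slice_le: "\<exists>q\<in>K. F (z0, w) = F q"
    if "\<And>p a. p \<in> ot_cover \<Longrightarrow> algebraic_int a \<Longrightarrow> F (act 1 a p) = F p" for F :: "_ \<Rightarrow> real" and w
    using slice[of w] that cover0 by metis
  have G_per: "G v (act 1 a p) = G v p" if "p \<in> ot_cover" "algebraic_int a" for v p a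
    by (simp add: G_def f_per[OF that] lift_translation[OF \<eta> that])
  have h_per: "h (act 1 a p) = h p" if "p \<in> ot_cover" "algebraic_int a" for p a
    by (simp add: h_def DG_def f_per[OF that] lift_translation[OF \<eta> that] lift_translation[OF \<theta> that]
        dlift_translation[OF \<eta> that])
  obtain q0 where q0: "q0 \<in> K" "\<And>q. q \<in> K \<Longrightarrow> h q0 \<le> h q"
  proof -
    have "continuous_on K h" unfolding h_def
      by (intro continuous_intros continuous_on_subset[OF contDG Kcover])
    then show ?thesis using continuous_attains_inf[OF K] K0 that by blast
  qed
  define c where "c = h q0"
  have c: "c > 0" unfolding c_def using h_pos q0(1) Kcover by blast
  have h_c: "h (z0, w) \<ge> c" for w using slice_le[of h w] h_per q0(2) by (auto simp: c_def)
  have "\<exists>M. \<forall>q\<in>K. \<bar>G v q\<bar> \<le> M" for v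
    using compact_imp_bounded[OF compact_continuous_image[OF continuous_on_subset[OF contG Kcover] K]]
    by (auto simp: bounded_iff)
  then obtain B where B: "\<And>v q. q \<in> K \<Longrightarrow> \<bar>G v q\<bar> \<le> B v" by metis
  have G_B: "\<bar>G v (z0, w)\<bar> \<le> B v" for v w using slice_le[of "G v" w] G_per B by metis
  define P where "P = (\<lambda>x y. (z0, 0) + x *\<^sub>R e1 + y *\<^sub>R e2)"
  have P_slice: "P x y = (z0, of_real x + \<i> * of_real y)" for x y
    by (simp add: P_def e1_def e2_def scaleR_conv_of_real mult.commute)
  have P: "P x y \<in> ot_cover" for x y by (simp add: P_slice cover0)
  have lin: "linear (DG v p)" if "p \<in> ot_cover" for v p using G_deriv[OF that] by (rule has_derivative_linear)
  have d1: "((\<lambda>y. G v (P x y)) has_real_derivative DG v (P x y) e2) (at y)" for v x y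
  proof -
    have "((\<lambda>y. P x y) has_derivative (\<lambda>h. h *\<^sub>R e2)) (at y)"
      unfolding P_def by (auto intro!: derivative_eq_intros)
    from has_derivative_compose[OF this G_deriv[OF P]]
    have "((\<lambda>y. G v (P x y)) has_derivative (\<lambda>h. DG v (P x y) (h *\<^sub>R e2))) (at y)" .
    moreover have "(\<lambda>h. DG v (P x y) (h *\<^sub>R e2)) = (*) (DG v (P x y) e2)"
      by (rule ext) (simp add: linear_scale[OF lin[OF P]])
    ultimately show ?thesis by (simp only: has_field_derivative_def)
  qed
  have d2: "((\<lambda>x. G v (P x y)) has_real_derivative DG v (P x y) e1) (at x)" for v x y
  proof -
    have "((\<lambda>x. P x y) has_derivative (\<lambda>h. h *\<^sub>R e1)) (at x)"
      unfolding P_def by (auto intro!: derivative_eq_intros)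
    from has_derivative_compose[OF this G_deriv[OF P]]
    have "((\<lambda>x. G v (P x y)) has_derivative (\<lambda>h. DG v (P x y) (h *\<^sub>R e1))) (at x)" .
    moreover have "(\<lambda>h. DG v (P x y) (h *\<^sub>R e1)) = (*) (DG v (P x y) e1)"
      by (rule ext) (simp add: linear_scale[OF lin[OF P]])
    ultimately show ?thesis by (simp only: has_field_derivative_def)
  qed
  show False
  proof (rule bounded_fields_no_positive_curl[of "\<lambda>x y. G e1 (P x y)" "\<lambda>x y. DG e1 (P x y) e2"
        "\<lambda>x y. G e2 (P x y)" "\<lambda>x y. DG e2 (P x y) e1" "max (B e1) (B e2)" c])
    have "continuous_on UNIV (\<lambda>p. P (fst p) (snd p))" unfolding P_def by (intro continuous_intros)
    then show "continuous_on UNIV (\<lambda>(x, y). DG e2 (P x y) e1)"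
      unfolding split_beta by (rule continuous_on_compose2[OF contDG]) (use P in auto)
    show "continuous_on UNIV (\<lambda>y. G e2 (P x y))" for x
      using d1 by (meson DERIV_isCont continuous_at_imp_continuous_on)
    show "\<bar>G e1 (P x y)\<bar> \<le> max (B e1) (B e2)" "\<bar>G e2 (P x y)\<bar> \<le> max (B e1) (B e2)" for x y
      using G_B unfolding P_slice by (simp_all add: le_max_iff_disj)
    show "c \<le> DG e2 (P x y) e1 - DG e1 (P x y) e2" for x y
      using h_c unfolding P_slice h_def by blast
  qed (fact d1 d2 c)+
qed

end

theorem proposition4p16:
  fixes \<sigma> :: "'s::finite \<Rightarrow> 'k::field_char_0 \<Rightarrow> real"
    and \<tau> :: "'k \<Rightarrow> complex"
    and U :: "'k set"
    and \<theta> :: "(((complex^'s) \<times> complex) set, (complex^'s) \<times> complex) field1"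
  assumes "oeljeklaus_toma_data \<sigma> \<tau> U"
    and "closed_one_form (ot_manifold \<sigma> \<tau> U) \<theta>"
  shows "\<not> (\<exists>\<omega>. lck_form_with_lee_form (ot_manifold \<sigma> \<tau> U) ot_J \<theta> \<omega> \<and>
                d_twisted_exact (ot_manifold \<sigma> \<tau> U) \<theta> \<omega>)"
proof -
  interpret oeljeklaus_toma \<sigma> \<tau> U using assms(1) by unfold_locales
  show ?thesis using no_exact_lck_form[OF assms(2)] by blast
qed

end
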